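(* Let $k \geq 4$ and let $\mathbb{A} = \{a_0, a_1, \ldots, a_{k-1}\}_{\vec r}$ be a sequence of nonnegative integers with $0 = a_0 < a_1 < \cdots < a_{k-1}$, $\vec r = (r_0, r_1, \ldots, r_{k-1})$ and $r_i \geq 1$ for all $i \in [0,k-1]$. Let $A = \{a_0,\ldots,a_{k-1}\}$ with $d(A) = 1$, let $r = \min\{r_1, \ldots, r_{k-1}\}$, and let $\alpha = \sum_{i=0}^{k-1} r_i - 2$. If $r = 1$, then \[ |S_\alpha(\mathbb{A})| \geq \begin{cases} a_{k-1} + k - 1 & \text{if } a_{k-1} \leq 2k-5,\\ (\theta+1)k - 5 & \text{if } a_{k-1} \geq 2k-4. \end{cases} \] If $r \geq 2$, then \[ |S_\alpha(\mathbb{A})| \geq \begin{cases} a_{k-1} + k & \text{if } a_{k-1} \leq 2k-3,\\ 3k - 3 & \text{if } a_{k-1} \geq 2k-2. \end{cases} \]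
   Context: The notation $\mathbb{A} = \{a_0, \ldots, a_{k-1}\}_{\vec r}$ with $\vec r = (r_0,\ldots,r_{k-1})$ means $\mathbb{A}$ is a finite sequence consisting of the $k$ distinct integers $a_0,\ldots,a_{k-1}$, where $a_i$ appears exactly $r_i$ times. For a positive integer $\alpha$, $S_\alpha(\mathbb{A}) = \{\sum_{b\in\mathbb{B}} b : \mathbb{B} \text{ a subsequence of } \mathbb{A},\ |\mathbb{B}| \geq \alpha\}$, where $|\mathbb{B}|$ counts terms with multiplicity. $d(A)$ is the gcd of the elements of $A$. $\theta = \frac{1+\sqrt5}{2}$. *)

theory Defs
  imports Complex_Main "HOL-Library.Multiset"
begin

text \<open>The order of the terms of a sequence plays no role for its subsequence sums, so finite
  sequences of integers are represented by multisets, and subsequences by submultisets.\<close>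

definition seq_of :: "nat \<Rightarrow> (nat \<Rightarrow> int) \<Rightarrow> (nat \<Rightarrow> nat) \<Rightarrow> int multiset" where
  "seq_of k a r = (\<Sum>i<k. replicate_mset (r i) (a i))"

definition subseq_sums :: "nat \<Rightarrow> int multiset \<Rightarrow> int set" where
  "subseq_sums \<alpha> M = {\<Sum>\<^sub># B | B. B \<subseteq># M \<and> size B \<ge> \<alpha>}"

definition golden :: real where
  "golden = (1 + sqrt 5) / 2"

end

theory Submission
  imports Defs "HOL-Library.Set_Algebras" "HOL-Analysis.Convex"
begin

text \<open>
  Taking complements, the sums of all but at most two terms are counted by \<open>0\<close> together with the sums
  of two distinct elements of \<open>A\<close> (Lev's restricted sumset), and by the full sumset \<open>A + A\<close> if no nonzero
  element is simple. Let \<open>l\<close> be the largest element, \<open>n = |A|\<close>, and let \<open>B\<close> be the image of \<open>A\<close> modulo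
  \<open>l\<close>, so that \<open>|B| = n - 1\<close>. Every residue in \<open>B\<close> other than 0 has two lifts \<open>a\<close> and \<open>a + l\<close> to a sumset,
  hence a sumset of \<open>A\<close> exceeds the corresponding sumset of \<open>B\<close> by about \<open>n\<close>. For small \<open>l\<close> the latter is everything
  by the pigeonhole principle. Otherwise Kneser's theorem gives either \<open>|B + B|\<close> about \<open>2|B|\<close>, or a large
  period, in which case one counts lifts coset by coset.

  What remains is the restricted sumset \<open>S\<close> of \<open>B\<close> (with 0 added) when the set \<open>W\<close> of all \<open>w\<close> in \<open>B\<close>
  with \<open>w + w\<close> outside \<open>S\<close> is nonempty. Then \<open>w + w\<close> has almost no representations, so \<open>|B + B|\<close> is about
  \<open>2|B|\<close> and \<open>|W| \<ge> 2|B| - |S|\<close> up to a constant. For \<open>w\<close> in \<open>W\<close> the relation \<open>w + b - x \<in> B\<close> between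
  \<open>x\<close> and \<open>b\<close> is antisymmetric, so the translate \<open>w + B\<close> meets the pairwise sums in at most about half of the
  possible incidences. Writing \<open>p c\<close> and \<open>q c\<close> for the number of representations of \<open>c\<close> with first summand in
  \<open>W\<close> and in \<open>B\<close>, this bounds the sum of \<open>p c * q c\<close> over \<open>S\<close> from above; the Cauchy-Schwarz inequality
  applied to \<open>4 p q = (p + q)\<^sup>2 - (q - p)\<^sup>2\<close> bounds it from below, and together they force \<open>|S|\<close> to be
  at least the golden ratio times \<open>n\<close>, minus 4.
\<close>

section \<open>Kneser's theorem\<close>

definition stab :: "'a::ab_group_add set \<Rightarrow> 'a set" where
  "stab C = {g. (+) g ` C = C}"

lemma card_translate [simp]: "card ((+) g ` C) = card (C :: 'a::ab_group_add set)"
  by (rule card_image) simp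

text \<open>Translation preserves cardinality, so a translation that maps a finite set into itself
  maps it onto itself.\<close>

lemma stabI:
  fixes C :: "'a::ab_group_add set"
  assumes "finite C" "\<And>x. x \<in> C \<Longrightarrow> g + x \<in> C"
  shows "g \<in> stab C"
  using card_subset_eq[of C "(+) g ` C"] assms by (auto simp: stab_def)

lemma stabD: "g \<in> stab C \<Longrightarrow> x \<in> C \<Longrightarrow> g + x \<in> C"
  unfolding stab_def by blast

lemma zero_in_stab [simp]: "0 \<in> stab C"
  by (simp add: stab_def)

lemma stab_add: "g \<in> stab C \<Longrightarrow> h \<in> stab C \<Longrightarrow> g + h \<in> stab C"
proof -
  assume "g \<in> stab C" "h \<in> stab C"
  then have "(+) g ` ((+) h ` C) = C" by (simp add: stab_def)
  then show ?thesis by (simp add: stab_def image_image add.assoc)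
qed

lemma stab_uminus: "g \<in> stab C \<Longrightarrow> - g \<in> stab C"
proof -
  assume g: "g \<in> stab C"
  then have "(+) (- g) ` C = (+) (- g) ` ((+) g ` C)" by (simp add: stab_def)
  then show ?thesis by (simp add: stab_def image_image add.assoc[symmetric])
qed

lemma stab_diff: "g \<in> stab C \<Longrightarrow> h \<in> stab C \<Longrightarrow> g - h \<in> stab C"
  using stab_add[OF _ stab_uminus] by fastforce

lemma stab_mem_iff: "g \<in> stab C \<Longrightarrow> g + x \<in> C \<longleftrightarrow> x \<in> C"
  using stabD[of g C x] stabD[OF stab_uminus, of g C "g + x"] by (auto simp: add.assoc[symmetric])

lemma finite_stab:
  fixes C :: "'a::ab_group_add set"
  assumes "finite C" "C \<noteq> {}"
  shows "finite (stab C)"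
proof -
  from assms obtain c where c: "c \<in> C" by blast
  have "stab C \<subseteq> (\<lambda>x. x - c) ` C"
  proof
    fix g assume "g \<in> stab C"
    then have "g + c \<in> C" using c by (rule stabD)
    then show "g \<in> (\<lambda>x. x - c) ` C" by force
  qed
  then show ?thesis using assms(1) finite_surj by blast
qed

lemma stab_translate: "stab ((+) g ` C) = stab C"
proof -
  have "(+) h ` (+) g ` C = (+) g ` C \<longleftrightarrow> (+) h ` C = C" for h
  proof -
    have "(+) h ` (+) g ` C = (+) g ` (+) h ` C"
      by (simp add: image_image add.left_commute)
    moreover have "inj ((+) g)" by simp
    ultimately show ?thesis by (simp only: inj_image_eq_iff)
  qed
  then show ?thesis by (simp add: stab_def)
qed

section \<open>Unions of periodic sets\<close>

lemma stab_inter_subset_stab_Un: "stab C \<inter> stab D \<subseteq> stab (C \<union> D)"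
  unfolding stab_def by (auto simp: image_Un)

text \<open>\<open>U\<close> is a union of \<open>H\<close>-cosets and \<open>V\<close> a union of \<open>K\<close>-cosets: within one coset of \<open>H + K\<close> these
  are independent events.\<close>

lemma card_inter_mult_coset:
  fixes H K :: "'a::ab_group_add set"
  assumes sub: "H = stab C" "K = stab E" and fin: "finite H" "finite K"
    and D: "D = (+) d ` (H + K)"
    and U: "U \<subseteq> D" "\<And>h x. h \<in> H \<Longrightarrow> x \<in> U \<Longrightarrow> h + x \<in> U"
    and V: "V \<subseteq> D" "\<And>h x. h \<in> K \<Longrightarrow> x \<in> V \<Longrightarrow> h + x \<in> V"
  shows "card (U \<inter> V) * card D = card U * card V"
proof -
  have finD: "finite D" unfolding D using fin by (simp add: finite_set_plus)
  have finU: "finite U" and finV: "finite V" using U(1) V(1) finD finite_subset by auto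
  \<comment> \<open>The \<open>H\<close>-cosets inside \<open>D\<close> are translates of one
    another by elements of \<open>K\<close>. Such translations preserve \<open>V\<close>, so all
    these cosets meet \<open>V\<close> in the same number \<open>k\<close> of elements.\<close>
  define k where "k = card ((+) d ` H \<inter> V)"
  have const: "card {v\<in>V. v - u \<in> H} = k" if uD: "u \<in> D" for u
  proof -
    obtain h1 h2 where h: "h1 \<in> H" "h2 \<in> K" "u = d + (h1 + h2)"
      using uD unfolding D by (auto elim!: set_plus_elim)
    have "{v\<in>V. v - u \<in> H} = (+) h2 ` ((+) d ` H \<inter> V)"
    proof (intro equalityI subsetI)
      fix v assume v: "v \<in> {v\<in>V. v - u \<in> H}"
      then have "v - u + h1 \<in> H" using stab_add[of "v - u" C h1] h(1) sub(1) by blast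
      then have "- h2 + v \<in> (+) d ` H"
        using h by (intro image_eqI[of _ _ "v - u + h1"]) (auto simp: algebra_simps)
      moreover have "- h2 + v \<in> V"
        using v h(2) sub(2) stab_uminus by (intro V(2)) auto
      ultimately show "v \<in> (+) h2 ` ((+) d ` H \<inter> V)"
        by (intro image_eqI[of _ _ "- h2 + v"]) auto
    next
      fix v assume "v \<in> (+) h2 ` ((+) d ` H \<inter> V)"
      then obtain h where hh: "h \<in> H" "d + h \<in> V" "v = h2 + (d + h)" by auto
      then have "v \<in> V" using V(2) h by auto
      moreover have "v - u = h - h1" using hh h by simp
      ultimately show "v \<in> {v\<in>V. v - u \<in> H}" using hh h sub stab_diff by auto
    qed
    then show ?thesis by (simp add: k_def)
  qed
  have fib: "card {u\<in>X. v - u \<in> H} = card H"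
    if "v \<in> X" "\<And>h x. h \<in> H \<Longrightarrow> x \<in> X \<Longrightarrow> h + x \<in> X" for v X
  proof -
    have "{u\<in>X. v - u \<in> H} = (\<lambda>h. v - h) ` H"
    proof (intro equalityI subsetI)
      fix u assume "u \<in> {u\<in>X. v - u \<in> H}"
      then show "u \<in> (\<lambda>h. v - h) ` H" by (intro image_eqI[of _ _ "v - u"]) auto
    next
      fix u assume "u \<in> (\<lambda>h. v - h) ` H"
      then obtain h where h: "h \<in> H" "u = v - h" by blast
      then have "- h + v \<in> X" using that sub stab_uminus by blast
      then show "u \<in> {u\<in>X. v - u \<in> H}" using h by simp
    qed
    then show ?thesis by (simp add: card_image inj_on_def)
  qed
  have swap: "(\<Sum>u\<in>X. card {v\<in>V. v - u \<in> H}) = (\<Sum>v\<in>V. card {u\<in>X. v - u \<in> H})"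
    if "finite X" for X
  proof -
    have "(\<Sum>u\<in>X. card {v\<in>V. v - u \<in> H}) = (\<Sum>u\<in>X. \<Sum>v\<in>V. if v - u \<in> H then 1 else 0)"
      using finV by (simp add: sum.If_cases Int_def)
    also have "\<dots> = (\<Sum>v\<in>V. \<Sum>u\<in>X. if v - u \<in> H then 1 else 0)" by (rule sum.swap)
    also have "\<dots> = (\<Sum>v\<in>V. card {u\<in>X. v - u \<in> H})"
      using that by (simp add: sum.If_cases Int_def)
    finally show ?thesis .
  qed
  have Dinv: "h + x \<in> D" if hH: "h \<in> H" and xD: "x \<in> D" for h x
  proof -
    obtain h1 h2 where "h1 \<in> H" "h2 \<in> K" "x = d + (h1 + h2)"
      using xD unfolding D by (auto elim!: set_plus_elim)
    moreover from this have "(h + h1) + h2 \<in> H + K" using hH sub stab_add by blast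
    ultimately show ?thesis unfolding D
      by (intro image_eqI[of _ _ "(h + h1) + h2"]) (auto simp: algebra_simps)
  qed
  \<comment> \<open>The pairs (u, v) with v - u in \<open>H\<close> are counted in two ways, first
    for u in \<open>D\<close>, then for u in \<open>U\<close>. In the second count an element of
    \<open>V\<close> has a full coset of partners if it lies in \<open>U\<close>, and none
    otherwise, because \<open>U\<close> is \<open>H\<close>-periodic.\<close>
  have "card D * k = (\<Sum>u\<in>D. card {v\<in>V. v - u \<in> H})" using const by simp
  also have "\<dots> = (\<Sum>v\<in>V. card {u\<in>D. v - u \<in> H})" by (rule swap[OF finD])
  also have "\<dots> = (\<Sum>v\<in>V. card H)" using V(1) Dinv by (intro sum.cong refl fib) auto
  finally have 1: "card D * k = card V * card H" by simp
  have "card U * k = (\<Sum>u\<in>U. card {v\<in>V. v - u \<in> H})" using const U(1) by (simp add: subset_iff)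
  also have "\<dots> = (\<Sum>v\<in>V. card {u\<in>U. v - u \<in> H})" by (rule swap[OF finU])
  also have "\<dots> = (\<Sum>v\<in>V. if v \<in> U then card H else 0)"
  proof (intro sum.cong refl)
    fix v assume "v \<in> V"
    show "card {u\<in>U. v - u \<in> H} = (if v \<in> U then card H else 0)"
    proof (cases "v \<in> U")
      case True then show ?thesis using fib U(2) by auto
    next
      case False
      have "{u\<in>U. v - u \<in> H} = {}"
      proof -
        have "v \<in> U" if "u \<in> U" "v - u \<in> H" for u using U(2)[OF that(2,1)] by simp
        then show ?thesis using False by blast
      qed
      then show ?thesis using False by (simp only: if_False card.empty)
    qed
  qed
  also have "\<dots> = card (U \<inter> V) * card H"
    using finV by (simp add: sum.If_cases Int_commute)
  finally have 2: "card U * k = card (U \<inter> V) * card H" .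
  have H0: "card H > 0" using fin sub by (metis card_gt_0_iff empty_iff zero_in_stab)
  have "card (U \<inter> V) * card D * card H = card U * card V * card H"
    using 1 2 by (metis mult.assoc mult.commute)
  then show ?thesis using H0 by simp
qed

lemma card_stab_mult:
  assumes fin: "finite (stab C)" "finite (stab E)"
  shows "card (stab C) * card (stab E) = card (stab C + stab E) * card (stab C \<inter> stab E)"
proof -
  have "card (stab C \<inter> stab E) * card ((+) 0 ` (stab C + stab E)) = card (stab C) * card (stab E)"
  proof (rule card_inter_mult_coset[OF refl refl fin refl])
    show "stab C \<subseteq> (+) 0 ` (stab C + stab E)" "stab E \<subseteq> (+) 0 ` (stab C + stab E)"
      using set_zero_plus2[OF zero_in_stab, of "stab C" E] set_zero_plus2[OF zero_in_stab, of "stab E" C]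
      by (simp_all add: add.commute)
  qed (auto intro: stab_add)
  then show ?thesis by (simp add: mult.commute)
qed

text \<open>The coset of \<open>H + K\<close> through \<open>x\<close> is a grid: its rows are
  \<open>H\<close>-cosets, its columns are \<open>K\<close>-cosets, and each cell has
  \<open>card (H \<inter> K)\<close> elements. Within it the complement of \<open>C1\<close> is a
  union of rows and that of \<open>C2\<close> a union of columns, so the two set differences contain
  complementary rectangles, which cannot both be small.\<close>

lemma card_Un_stab_aux:
  fixes C1 C2 :: "'a::ab_group_add set"
  assumes fin: "finite C1" "finite C2" and x: "x \<in> C2" "x \<notin> C1"
  shows "card (C2 - C1) + card (stab C1 \<inter> stab C2) \<ge> card (stab C1) \<or>
    card (C1 - C2) + card (stab C1 \<inter> stab C2) \<ge> card (stab C2) \<or>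
    card (C2 - C1) \<ge> card (stab C2)"
proof (cases "C1 = {}")
  case True
  have "card (stab C2) \<le> card C2"
    using card_inj_on_le[of "\<lambda>g. g + x" "stab C2" C2] stabD[OF _ x(1)] fin by (auto simp: inj_on_def)
  then show ?thesis using True by simp
next
  case False
  define H where "H = stab C1"
  define K where "K = stab C2"
  have fH: "finite H" and fK: "finite K" unfolding H_def K_def using fin False x finite_stab by blast+
  define D where "D = (+) x ` (H + K)"
  define U where "U = D - C1"
  define V where "V = D - C2"
  have finD: "finite D" unfolding D_def using fH fK by (simp add: finite_set_plus)
  have xD: "x \<in> D"
    unfolding D_def using set_plus_intro[of 0 H 0 K] by (auto simp: H_def K_def image_iff)
  have Dinv: "h + y \<in> D" if hHK: "h \<in> H \<union> K" and yD: "y \<in> D" for h y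
  proof -
    obtain h1 h2 where y: "h1 \<in> H" "h2 \<in> K" "y = x + (h1 + h2)"
      using yD unfolding D_def by (auto elim!: set_plus_elim)
    have "h + h1 + h2 \<in> H + K"
    proof (cases "h \<in> H")
      case True then show ?thesis using y stab_add unfolding H_def by blast
    next
      case False
      then have "h1 + (h + h2) \<in> H + K" using y hHK stab_add unfolding K_def by blast
      then show ?thesis by (simp add: algebra_simps)
    qed
    then show ?thesis unfolding D_def using y
      by (intro image_eqI[of _ _ "h + h1 + h2"]) (auto simp: algebra_simps)
  qed
  have U: "U \<subseteq> D" "\<And>h y. h \<in> H \<Longrightarrow> y \<in> U \<Longrightarrow> h + y \<in> U"
    unfolding U_def using Dinv stab_mem_iff[of _ C1] by (auto simp: H_def)
  have V: "V \<subseteq> D" "\<And>h y. h \<in> K \<Longrightarrow> y \<in> V \<Longrightarrow> h + y \<in> V"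
    unfolding V_def using Dinv stab_mem_iff[of _ C2] by (auto simp: K_def)
  have D: "D = (+) x ` (H + K)" by (simp add: D_def)
  have UV: "card (U \<inter> V) * card D = card U * card V"
    by (rule card_inter_mult_coset[OF H_def K_def fH fK D U V])
  have card_HK: "card H * card K = card D * card (H \<inter> K)"
    unfolding D using card_stab_mult[of C1 C2] fH fK by (simp add: H_def K_def)
  have le: "card T \<le> card X" if "finite X" "T = stab Y" "y \<in> X" "\<And>h. h \<in> T \<Longrightarrow> h + y \<in> X" for T X Y y
    using card_inj_on_le[of "\<lambda>g. g + y" T X] that by (auto simp: inj_on_def)
  have xU: "x \<in> U" and xV: "x \<notin> V" using x xD by (auto simp: U_def V_def)
  have finU: "finite U" and finV: "finite V" using finD U(1) V(1) finite_subset by blast+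
  have hU: "card H \<le> card U" using le[OF finU H_def xU] U(2) xU by blast
  have kD: "card K \<le> card (D - V)"
  proof (rule le[OF _ K_def])
    show "finite (D - V)" "x \<in> D - V" using finD xD xV by auto
    show "h + x \<in> D - V" if "h \<in> K" for h
      using that stabD[OF _ x(1), of h] Dinv xD by (auto simp: V_def K_def)
  qed
  have cDV: "card (D - V) = card D - card V" and cDU: "card (D - U) = card D - card U"
    and VD: "card V \<le> card D" and UD: "card U \<le> card D"
    using finD finU finV U V by (auto simp: card_Diff_subset card_mono)
  have sub1: "card (U - V) \<le> card (C2 - C1)" and sub2: "card (V - U) \<le> card (C1 - C2)"
    using fin by (auto intro!: card_mono simp: U_def V_def)
  have cUV: "card (U - V) = card U - card (U \<inter> V)" "card (V - U) = card V - card (U \<inter> V)"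
    using finU finV by (auto simp: card_Diff_subset_Int Int_commute)
  have iUV: "card (U \<inter> V) \<le> card U" "card (U \<inter> V) \<le> card V"
    using finU finV by (auto intro: card_mono)
  have Hpos: "card H > 0" "card K > 0" "card (H \<inter> K) > 0"
    using fH fK by (auto simp: card_gt_0_iff H_def K_def intro: zero_in_stab)
  have Dpos: "card D > 0" using xD finD by (auto simp: card_gt_0_iff)
  \<comment> \<open>\<open>U\<close> consists of \<open>a\<close> of the \<open>q\<close> rows, and
    \<open>b\<close> of the \<open>p\<close> columns lie outside \<open>V\<close>. Hence
    \<open>U - V\<close> is an \<open>a\<close> by \<open>b\<close> rectangle of cells and
    \<open>V - U\<close> is a \<open>q - a\<close> by \<open>p - b\<close> rectangle.\<close>
  define a where "a = real (card U) / real (card H)"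
  define b where "b = real (card (D - V)) / real (card K)"
  define N where "N = real (card D)"
  define h0 where "h0 = real (card (H \<inter> K))"
  define p where "p = real (card H) / h0"
  define q where "q = real (card K) / h0"
  have pos: "N > 0" "h0 > 0" "p > 0" "q > 0"
    using Hpos Dpos by (auto simp: N_def h0_def p_def q_def)
  have Hp: "real (card H) = p * h0" and Kq: "real (card K) = q * h0"
    using pos by (simp_all add: p_def q_def)
  have Npq: "N = p * q * h0"
  proof -
    have "(p * h0) * (q * h0) = N * h0"
      using card_HK Hp Kq unfolding N_def h0_def by (metis of_nat_mult)
    then show ?thesis using pos by simp
  qed
  have cU: "real (card U) = a * p * h0" using pos by (simp add: a_def Hp)
  have cV: "real (card V) = N - b * q * h0"
  proof -
    have "b * q * h0 = real (card (D - V))" using pos by (simp add: b_def Kq)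
    then show ?thesis using cDV VD by (simp add: N_def)
  qed
  have UVr: "real (card (U \<inter> V)) * N = real (card U) * real (card V)"
    using UV unfolding N_def by (metis of_nat_mult)
  have UVval: "real (card (U \<inter> V)) = a * p * h0 - a * b * h0"
  proof -
    have "real (card (U \<inter> V)) * N = (a * p * h0 - a * b * h0) * N"
      unfolding UVr cU cV using Npq by (simp add: algebra_simps)
    then show ?thesis using pos by simp
  qed
  have c1: "real (card (U - V)) = a * b * h0"
    using cUV(1) iUV(1) UVval cU by simp
  have c2: "real (card (V - U)) = (q - a) * (p - b) * h0"
    using cUV(2) iUV(2) UVval cV Npq by (simp add: algebra_simps)
  have a1: "a \<ge> 1" using hU Hpos by (simp add: a_def)
  have b1: "b \<ge> 1" using kD Hpos by (simp add: b_def)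
  consider "V = {}" | "U = D" | "V \<noteq> {}" "U \<noteq> D" by blast
  then show ?thesis
  proof cases
    case 1
    then have "card H \<le> card (C2 - C1)" using hU sub1 by simp
    then show ?thesis unfolding H_def by linarith
  next
    case 2
    then have "card K \<le> card (C2 - C1)" using kD sub1 by simp
    then show ?thesis unfolding K_def by linarith
  next
    case 3
    then obtain v where v: "v \<in> V" by blast
    obtain u where u: "u \<in> D" "u \<notin> U" using 3 U by blast
    have "card K \<le> card V" using le[OF finV K_def v] V(2) v by blast
    then have "q * h0 \<le> N - b * q * h0" using Kq cV by simp
    then have "q * h0 * (b + 1) \<le> q * h0 * p" using Npq by (simp add: algebra_simps)
    then have pb: "p - b \<ge> 1" using pos by simp
    have "card H \<le> card (D - U)"
    proof (rule le[OF _ H_def])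
      show "finite (D - U)" "u \<in> D - U" using finD u by auto
      show "h + u \<in> D - U" if "h \<in> H" for h
        using that u Dinv stabD[of h C1 u] by (auto simp: U_def H_def)
    qed
    then have "p * h0 \<le> N - a * p * h0" using Hp cU cDU UD by (simp add: N_def)
    then have "p * h0 * (a + 1) \<le> p * h0 * q" using Npq by (simp add: algebra_simps)
    then have qa: "q - a \<ge> 1" using pos by simp
    \<comment> \<open>All four side lengths are at least 1. The two products add up to a lower bound
      for the total area of both rectangles, so one of them reaches its share of it.\<close>
    have "(a - 1) * (b - 1) \<ge> 0" using a1 b1 by simp
    moreover have "(q - a - 1) * (p - b - 1) \<ge> 0" using pb qa by simp
    ultimately have "a * b + (q - a) * (p - b) \<ge> (p - 1) + (q - 1)"
      by (simp add: algebra_simps)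
    then have "a * b \<ge> p - 1 \<or> (q - a) * (p - b) \<ge> q - 1" by linarith
    then show ?thesis
    proof
      assume "a * b \<ge> p - 1"
      then have "(p - 1) * h0 \<le> a * b * h0" using pos by (intro mult_right_mono) auto
      then have "real (card H) \<le> real (card (U - V)) + h0" using c1 Hp by (simp add: algebra_simps)
      then have "card H \<le> card (U - V) + card (H \<inter> K)" unfolding h0_def by linarith
      then show ?thesis using sub1 unfolding H_def K_def by linarith
    next
      assume "(q - a) * (p - b) \<ge> q - 1"
      then have "(q - 1) * h0 \<le> (q - a) * (p - b) * h0" using pos by (intro mult_right_mono) auto
      then have "real (card K) \<le> real (card (V - U)) + h0" using c2 Kq by (simp add: algebra_simps)
      then have "card K \<le> card (V - U) + card (H \<inter> K)" unfolding h0_def by linarith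
      then show ?thesis using sub2 unfolding H_def K_def by linarith
    qed
  qed
qed

text \<open>This is the merging step of Kneser's argument: it allows subsets of a sumset found
  around single elements to be joined.\<close>

lemma card_Un_stab:
  fixes C1 C2 :: "'a::ab_group_add set"
  assumes fin: "finite C1" "finite C2" and ne: "C1 \<noteq> {}" "C2 \<noteq> {}"
    and le: "N \<le> card C1 + card (stab C1)" "N \<le> card C2 + card (stab C2)"
  shows "N \<le> card (C1 \<union> C2) + card (stab (C1 \<union> C2))"
proof -
  consider "C2 \<subseteq> C1" | "C1 \<subseteq> C2" | x y where "x \<in> C2" "x \<notin> C1" "y \<in> C1" "y \<notin> C2" by blast
  then show ?thesis
  proof cases
    case 1 then show ?thesis using le by (simp add: Un_absorb2)
  next
    case 2 then show ?thesis using le by (simp add: Un_absorb1)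
  next
    case 3
    have "finite (stab (C1 \<union> C2))" using fin ne by (intro finite_stab) auto
    then have s: "card (stab C1 \<inter> stab C2) \<le> card (stab (C1 \<union> C2))"
      by (intro card_mono stab_inter_subset_stab_Un)
    have c: "card (C1 \<union> C2) = card C1 + card (C2 - C1)" "card (C1 \<union> C2) = card C2 + card (C1 - C2)"
      using fin by (auto simp flip: card_Un_disjoint simp: Un_commute Un_Diff_cancel2)
    \<comment> \<open>If only the third alternative holds in both directions, the union has at least
      \<open>card C1 + card (stab C2)\<close> and at least \<open>card C2 + card (stab C1)\<close>
      elements. These two bounds add up to at least \<open>2 * N\<close>, so one of them is at least
      \<open>N\<close>.\<close>
    show ?thesis
      using card_Un_stab_aux[OF fin 3(1,2)] card_Un_stab_aux[OF fin(2,1) 3(3,4)] s c le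
      by (auto simp: Int_commute)
  qed
qed

section \<open>Kneser's theorem by the Dyson transform\<close>

text \<open>Induction on \<open>card B\<close>. The Dyson transform at \<open>e\<close> adds e + B
  to \<open>A\<close> and keeps in \<open>B\<close> only what \<open>e\<close> already moved into
  \<open>A\<close>; this preserves the total cardinality and does not enlarge the sumset. If no
  transform changes anything, \<open>B\<close> consists of periods of \<open>A\<close>, and
  \<open>A\<close> itself serves as \<open>C\<close>.\<close>

lemma ex_subset_card_stab_zero:
  fixes A B :: "'a::ab_group_add set"
  assumes "finite A" "finite B" "0 \<in> A" "0 \<in> B"
  shows "\<exists>C. C \<subseteq> A + B \<and> 0 \<in> C \<and> card A + card B \<le> card C + card (stab C)"
  using assms
proof (induction "card B" arbitrary: A B rule: less_induct)
  case less
  show ?case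
  proof (cases "\<forall>e\<in>A. \<forall>b\<in>B. e + b \<in> A")
    case True
    have "b + a \<in> A" if "b \<in> B" "a \<in> A" for a b
      using True that by (simp add: add.commute[of b a])
    then have "B \<subseteq> stab A" using less.prems(1) by (auto intro!: stabI)
    moreover have "finite (stab A)" using less.prems by (intro finite_stab) auto
    ultimately have "card B \<le> card (stab A)" by (simp add: card_mono)
    moreover have "A \<subseteq> A + B" using set_zero_plus2[OF less.prems(4), of A] by (simp add: add.commute)
    ultimately show ?thesis using less.prems(3) by (intro exI[of _ A]) auto
  next
    case False
    then obtain e b where e: "e \<in> A" "b \<in> B" "e + b \<notin> A" by blast
    define A' where "A' = A \<union> (+) e ` B"
    define B' where "B' = {b\<in>B. e + b \<in> A}"
    have "card B' < card B" using e less.prems(2) unfolding B'_def by (intro psubset_card_mono) auto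
    moreover have "finite A'" "finite B'" "0 \<in> A'" "0 \<in> B'"
      using less.prems e by (auto simp: A'_def B'_def)
    ultimately obtain C where C: "C \<subseteq> A' + B'" "0 \<in> C" "card A' + card B' \<le> card C + card (stab C)"
      using less.hyps by blast
    have "card A' + card B' = card A + card B"
    proof -
      have "A' = A \<union> (+) e ` (B - B')" by (auto simp: A'_def B'_def)
      moreover have "A \<inter> (+) e ` (B - B') = {}" by (auto simp: B'_def)
      ultimately have "card A' = card A + card (B - B')"
        using less.prems by (simp add: card_Un_disjoint)
      moreover have "card (B - B') = card B - card B'" "card B' \<le> card B"
        using less.prems by (auto simp: B'_def card_Diff_subset card_mono)
      ultimately show ?thesis by simp
    qed
    moreover have "A' + B' \<subseteq> A + B"
    proof
      fix z assume "z \<in> A' + B'"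
      then obtain x y where z: "z = x + y" "x \<in> A'" "y \<in> B'" by (rule set_plus_elim)
      show "z \<in> A + B"
      proof (cases "x \<in> A")
        case True then show ?thesis using z by (auto simp: B'_def)
      next
        case False
        then obtain b' where "b' \<in> B" "x = e + b'" using z by (auto simp: A'_def)
        then have "z = (e + y) + b'" using z by (simp add: algebra_simps)
        moreover have "e + y \<in> A" using z by (simp add: B'_def)
        ultimately show ?thesis using \<open>b' \<in> B\<close> by blast
      qed
    qed
    ultimately show ?thesis using C by (intro exI[of _ C]) auto
  qed
qed

lemma ex_subset_card_stab:
  fixes A B :: "'a::ab_group_add set"
  assumes "finite A" "finite B" "c \<in> A + B"
  shows "\<exists>C. C \<subseteq> A + B \<and> c \<in> C \<and> card A + card B \<le> card C + card (stab C)"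
proof -
  obtain a b where ab: "c = a + b" "a \<in> A" "b \<in> B" using assms(3) by (rule set_plus_elim)
  have "\<exists>C. C \<subseteq> (+) (- a) ` A + (+) (- b) ` B \<and> 0 \<in> C \<and>
    card ((+) (- a) ` A) + card ((+) (- b) ` B) \<le> card C + card (stab C)"
    using ab assms by (intro ex_subset_card_stab_zero) (auto simp: image_iff)
  then obtain C where C: "C \<subseteq> (+) (- a) ` A + (+) (- b) ` B" "0 \<in> C"
    "card A + card B \<le> card C + card (stab C)" unfolding card_translate by blast
  have "(+) c ` C \<subseteq> A + B"
  proof
    fix z assume "z \<in> (+) c ` C"
    then obtain y where y: "y \<in> C" "z = c + y" by blast
    then obtain u v where "u \<in> A" "v \<in> B" "y = (- a + u) + (- b + v)"
      using C(1) by (auto elim!: set_plus_elim)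
    then have "z = u + v" using y ab by (simp add: algebra_simps)
    then show "z \<in> A + B" using \<open>u \<in> A\<close> \<open>v \<in> B\<close> by blast
  qed
  moreover have "c \<in> (+) c ` C" using C(2) by force
  ultimately show ?thesis using C(3) by (intro exI[of _ "(+) c ` C"]) (simp add: stab_translate)
qed

text \<open>The good sets cover the sumset and are closed under union, so a largest one is the whole
  sumset.\<close>

theorem Kneser_weak:
  fixes A B :: "'a::ab_group_add set"
  assumes "finite A" "finite B" "A \<noteq> {}" "B \<noteq> {}"
  shows "card A + card B \<le> card (A + B) + card (stab (A + B))"
proof -
  define good where "good C \<longleftrightarrow> C \<subseteq> A + B \<and> C \<noteq> {} \<and> card A + card B \<le> card C + card (stab C)" for C
  have finAB: "finite (A + B)" using assms by (simp add: finite_set_plus)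
  have cover: "\<exists>C. good C \<and> c \<in> C" if "c \<in> A + B" for c
    using ex_subset_card_stab[OF assms(1,2) that] unfolding good_def by blast
  obtain a b where "a \<in> A" "b \<in> B" using assms by blast
  then obtain C0 where "good C0" using cover by blast
  then have "\<exists>C. good C \<and> (\<forall>E. good E \<longrightarrow> card E \<le> card C)"
    using ex_has_greatest_nat[of good C0 card "card (A + B) + 1"] finAB
    by (auto simp: good_def card_mono less_Suc_eq_le)
  then obtain C where C: "good C" "\<And>E. good E \<Longrightarrow> card E \<le> card C" by blast
  have "c \<in> C" if "c \<in> A + B" for c
  proof -
    obtain E where E: "good E" "c \<in> E" using cover \<open>c \<in> A + B\<close> by blast
    have fin: "finite C" "finite E" using C E finAB finite_subset by (auto simp: good_def)
    have "good (C \<union> E)"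
      using card_Un_stab[OF fin, of "card A + card B"] C(1) E(1) by (auto simp: good_def)
    then have "card (C \<union> E) \<le> card C" by (rule C(2))
    then have "C \<union> E = C" using fin card_subset_eq[of "C \<union> E" C] card_mono[of "C \<union> E" C] by auto
    then show ?thesis using E by blast
  qed
  then have "C = A + B" using C(1) by (auto simp: good_def)
  then show ?thesis using C(1) by (simp add: good_def)
qed

text \<open>Replacing both summands by their \<open>H\<close>-saturations leaves the sumset
  unchanged, so the weak form applied to the saturations is already the sharper inequality.\<close>

theorem Kneser:
  fixes A B :: "'a::ab_group_add set"
  assumes "finite A" "finite B" "A \<noteq> {}" "B \<noteq> {}" and H: "H = stab (A + B)"
  shows "card (A + H) + card (B + H) \<le> card (A + B) + card H"
proof -
  have fin: "finite (A + B)" using assms by (simp add: finite_set_plus)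
  have finH: "finite H" unfolding H using fin assms by (intro finite_stab) (auto simp: set_plus_def)
  have "(A + H) + (B + H) = A + B"
  proof (intro equalityI subsetI)
    fix x assume "x \<in> (A + H) + (B + H)"
    then obtain a b h h' where "a \<in> A" "b \<in> B" "h \<in> H" "h' \<in> H" "x = a + h + (b + h')"
      by (auto elim!: set_plus_elim)
    then have "x = (h + h') + (a + b)" "h + h' \<in> stab (A + B)" "a + b \<in> A + B"
      using stab_add H by (auto simp: algebra_simps)
    then show "x \<in> A + B" using stabD by blast
  next
    fix x assume "x \<in> A + B"
    then obtain a b where "a \<in> A" "b \<in> B" "x = (a + 0) + (b + 0)" by (auto elim!: set_plus_elim)
    moreover have "0 \<in> H" using H by simp
    ultimately show "x \<in> (A + H) + (B + H)" by blast
  qed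
  moreover have "A + H \<noteq> {}" "B + H \<noteq> {}"
    using assms(3,4) set_zero_plus2[of H A] set_zero_plus2[of H B] H by (auto simp: add.commute)
  ultimately show ?thesis
    using Kneser_weak[of "A + H" "B + H"] finH assms by (simp add: finite_set_plus)
qed

section \<open>Restricted sumsets in abelian groups\<close>

lemma subset_plus_stab: "B \<subseteq> B + stab C"
  using set_zero_plus2[OF zero_in_stab, of B C] by (simp add: add.commute)

text \<open>The coset of \<open>x\<close> lies in \<open>B + H\<close>, so \<open>B\<close> has no
  more holes in it than in all of \<open>B + H\<close>.\<close>

lemma card_stab_le_coset:
  fixes B :: "'a::ab_group_add set"
  assumes fin: "finite B" "finite H" and H: "H = stab C" and x: "x \<in> B"
  shows "card H + card B \<le> card {z\<in>B. z - x \<in> H} + card (B + H)"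
proof -
  have sub: "B \<subseteq> B + H" using subset_plus_stab H by simp
  have finBH: "finite (B + H)" using fin by (simp add: finite_set_plus)
  have "(+) x ` H \<subseteq> {z\<in>B. z - x \<in> H} \<union> ((B + H) - B)" using x by auto
  then have "card ((+) x ` H) \<le> card ({z\<in>B. z - x \<in> H} \<union> ((B + H) - B))"
    using fin finBH by (intro card_mono) auto
  also have "\<dots> \<le> card {z\<in>B. z - x \<in> H} + card ((B + H) - B)" by (rule card_Un_le)
  also have "card ((B + H) - B) = card (B + H) - card B" using sub fin by (simp add: card_Diff_subset)
  finally show ?thesis using card_mono[OF finBH sub] by simp
qed

text \<open>For c = x + y, the part of \<open>B\<close> in x + H and the reflection under c - z of
  its part in y + H share one coset of \<open>H\<close>. By Kneser's theorem both have few holes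
  there, hence they overlap, and every common element is a representation of
  \<open>c\<close>.\<close>

theorem Kemperman_Scherk:
  fixes B :: "'a::ab_group_add set"
  assumes fin: "finite B" and c: "c \<in> B + B"
  shows "2 * card B \<le> card (B + B) + card {x\<in>B. c - x \<in> B}"
proof -
  define H where "H = stab (B + B)"
  have ne: "B \<noteq> {}" using c by auto
  have finBB: "finite (B + B)" using fin by (simp add: finite_set_plus)
  have finH: "finite H" unfolding H_def using finBB c by (intro finite_stab) auto
  have K: "2 * card (B + H) \<le> card (B + B) + card H"
    using Kneser[OF fin fin ne ne H_def] by simp
  obtain x y where xy: "c = x + y" "x \<in> B" "y \<in> B" using c by (rule set_plus_elim)
  define P where "P = {z\<in>B. z - x \<in> H}"
  define Q where "Q = (\<lambda>z. c - z) ` {z\<in>B. z - y \<in> H}"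
  have cQ: "card Q = card {z\<in>B. z - y \<in> H}" unfolding Q_def by (rule card_image) (simp add: inj_on_def)
  have finPQ: "finite P" "finite Q" using fin by (auto simp: P_def Q_def)
  have "P \<union> Q \<subseteq> (+) x ` H"
  proof
    fix u assume "u \<in> P \<union> Q"
    then consider "u - x \<in> H" | z where "u = c - z" "z - y \<in> H" by (auto simp: P_def Q_def)
    then have "u - x \<in> H"
    proof cases
      case 2
      then have "u - x = - (z - y)" using xy by simp
      then show ?thesis using stab_uminus[of "z - y" "B + B"] 2(2) unfolding H_def by metis
    qed
    then show "u \<in> (+) x ` H" by (intro image_eqI[of _ _ "u - x"]) auto
  qed
  then have "card (P \<union> Q) \<le> card H"
    using card_mono[of "(+) x ` H" "P \<union> Q"] finH by simp
  moreover have "card P + card Q = card (P \<union> Q) + card (P \<inter> Q)"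
    using finPQ by (rule card_Un_Int)
  moreover have "card (P \<inter> Q) \<le> card {x\<in>B. c - x \<in> B}"
    using fin by (intro card_mono) (auto simp: P_def Q_def)
  moreover have "card H + card B \<le> card P + card (B + H)" "card H + card B \<le> card Q + card (B + H)"
    using card_stab_le_coset[OF fin finH H_def] xy cQ by (auto simp: P_def)
  ultimately show ?thesis using K by linarith
qed

section \<open>Restricted sumsets and their incidences\<close>

definition rsum :: "'a::ab_group_add set \<Rightarrow> 'a set" where
  "rsum A = {x + y |x y. x \<in> A \<and> y \<in> A \<and> x \<noteq> y}"

lemma rsumI: "x \<in> A \<Longrightarrow> y \<in> A \<Longrightarrow> x \<noteq> y \<Longrightarrow> x + y \<in> rsum A"
  by (auto simp: rsum_def)

lemma finite_rsum: "finite A \<Longrightarrow> finite (rsum A)"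
  by (rule finite_subset[of _ "A + A"]) (auto simp: rsum_def finite_set_plus)

lemma subset_insert_rsum: "0 \<in> B \<Longrightarrow> B \<subseteq> insert 0 (rsum B)"
proof
  fix b assume "0 \<in> B" "b \<in> B"
  then show "b \<in> insert 0 (rsum B)"
    using rsumI[of 0 B b] by (cases "b = 0") auto
qed

text \<open>Pairs of distinct elements are grouped by their sum. With \<open>f\<close> constant this
  counts pairs; with \<open>f\<close> a representation function it counts incidences.\<close>

lemma sum_rsum_reindex:
  fixes f :: "'a::ab_group_add \<Rightarrow> nat"
  assumes "finite B" "X \<subseteq> B" "finite S" "rsum B \<subseteq> S"
  shows "(\<Sum>x\<in>X. \<Sum>b\<in>B - {x}. f (x + b)) = (\<Sum>c\<in>S. card {x\<in>X. c - x \<in> B \<and> c - x \<noteq> x} * f c)"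
proof -
  have finX: "finite X" using assms finite_subset by blast
  have "(\<Sum>b\<in>B - {x}. f (x + b)) = (\<Sum>c\<in>S. if c - x \<in> B \<and> c - x \<noteq> x then f c else 0)" if "x \<in> X" for x
  proof -
    have "(\<Sum>b\<in>B - {x}. f (x + b)) = (\<Sum>c\<in>{c\<in>S. c - x \<in> B \<and> c - x \<noteq> x}. f c)"
    proof (rule sum.reindex_bij_witness[of _ "\<lambda>c. c - x" "\<lambda>b. x + b"])
      fix b assume b: "b \<in> B - {x}"
      then have "x + b \<in> rsum B" using that assms by (intro rsumI) auto
      then show "x + b \<in> {c\<in>S. c - x \<in> B \<and> c - x \<noteq> x}" using b assms by auto
    qed auto
    also have "\<dots> = (\<Sum>c\<in>S. if c - x \<in> B \<and> c - x \<noteq> x then f c else 0)"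
      using assms(3) by (simp add: sum.inter_filter)
    finally show ?thesis .
  qed
  then have "(\<Sum>x\<in>X. \<Sum>b\<in>B - {x}. f (x + b))
    = (\<Sum>x\<in>X. \<Sum>c\<in>S. if c - x \<in> B \<and> c - x \<noteq> x then f c else 0)" by simp
  also have "\<dots> = (\<Sum>c\<in>S. \<Sum>x\<in>X. if c - x \<in> B \<and> c - x \<noteq> x then f c else 0)" by (rule sum.swap)
  also have "\<dots> = (\<Sum>c\<in>S. card {x\<in>X. c - x \<in> B \<and> c - x \<noteq> x} * f c)"
    using finX by (simp add: sum.If_cases Int_def)
  finally show ?thesis .
qed

text \<open>\<open>R\<close> and its converse together lie in the off-diagonal pairs, and they
  overlap only in the exceptional pairs indexed by \<open>E\<close>.\<close>

lemma card_antisymmetric_le: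
  assumes fin: "finite C" and R: "R \<subseteq> C \<times> C - Id"
    and I: "\<And>b x. (b, x) \<in> R \<Longrightarrow> (x, b) \<in> R \<Longrightarrow> x \<in> E \<and> b = h x" and E: "finite E"
  shows "2 * card R \<le> card C * (card C - 1) + card E"
proof -
  have finR: "finite R" using R fin finite_subset by blast
  have "card (R \<inter> R\<inverse>) \<le> card ((\<lambda>x. (h x, x)) ` E)"
    using I E by (intro card_mono) auto
  also have "\<dots> \<le> card E" using E by (rule card_image_le)
  finally have 1: "card (R \<inter> R\<inverse>) \<le> card E" .
  have "R \<union> R\<inverse> \<subseteq> C \<times> C - Id" using R by auto
  then have "card (R \<union> R\<inverse>) \<le> card (C \<times> C - Id)" using fin by (intro card_mono) auto
  also have "C \<times> C - Id = C \<times> C - (\<lambda>x. (x, x)) ` C" by auto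
  also have "card \<dots> = card C * card C - card C"
    using fin by (subst card_Diff_subset) (auto simp: card_image inj_on_def card_cartesian_product)
  finally have 2: "card (R \<union> R\<inverse>) \<le> card C * (card C - 1)" by (simp add: diff_mult_distrib2)
  have "card R + card (R\<inverse>) = card (R \<union> R\<inverse>) + card (R \<inter> R\<inverse>)"
    using finR by (intro card_Un_Int) auto
  moreover have "card (R\<inverse>) = card R" by (rule card_inverse)
  ultimately show ?thesis using 1 2 by simp
qed

text \<open>Call \<open>x\<close> a predecessor of \<open>b\<close> if \<open>w + b - x\<close> lies in \<open>B\<close>. Two distinct elements that precede each
  other give two elements of \<open>B\<close> with sum \<open>w + w\<close>, so they differ by the 2-torsion element \<open>t\<close>.\<close>

lemma card_triples_le:
  fixes B :: "'a::ab_group_add set"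
  assumes fin: "finite B" and w: "w \<in> B" "w + w \<notin> rsum B"
    and t2: "\<And>x::'a. x + x = 0 \<Longrightarrow> x = 0 \<or> x = t"
  shows "2 * (\<Sum>b\<in>B - {w}. card {x\<in>B. w + b - x \<in> B \<and> w + b - x \<noteq> x})
    \<le> (card B - 1) * (card B + 2)
      + (if \<exists>w'\<in>B. w' \<noteq> w \<and> w' + w' = w + w then card B - 2 else 0)"
proof -
  define C where "C = B - {w}"
  have finC: "finite C" and cC: "card C = card B - 1" using fin w by (auto simp: C_def)
  define R where "R = {(b, x). b \<in> C \<and> x \<in> C \<and> b \<noteq> x \<and> w + b - x \<in> B \<and> w + b - x \<noteq> x}"
  \<comment> \<open>Mutual predecessors can occur only if w + t is a second element of
    \<open>B\<close> with double w + w. The element w + t itself is left out, because its partner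
    would be \<open>w\<close>, which is not in \<open>C\<close>.\<close>
  define E where "E = (if \<exists>w'\<in>B. w' \<noteq> w \<and> w' + w' = w + w then C - {w + t} else {})"
  have "2 * card R \<le> card C * (card C - 1) + card E"
  proof (rule card_antisymmetric_le[OF finC, of R E "\<lambda>x. x + t"])
    show "R \<subseteq> C \<times> C - Id" by (auto simp: R_def)
    show "finite E" using finC by (auto simp: E_def)
    fix b x assume bx: "(b, x) \<in> R" "(x, b) \<in> R"
    then have y: "w + b - x \<in> B" "w + x - b \<in> B" "b \<noteq> x" "w + b - x \<noteq> x" "x \<in> C" by (auto simp: R_def)
    have "w + b - x = w + x - b"
    proof (rule ccontr)
      assume "w + b - x \<noteq> w + x - b"
      then have "(w + b - x) + (w + x - b) \<in> rsum B" using y by (intro rsumI)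
      then show False using w by simp
    qed
    then have "(b - x) + (b - x) = 0" by (simp add: algebra_simps)
    then have t: "b - x = t" using t2[of "b - x"] y by auto
    then have tt: "t + t = 0" using \<open>(b - x) + (b - x) = 0\<close> by simp
    have wt: "w + t \<in> B" using y t by (simp add: algebra_simps)
    moreover have "t \<noteq> 0" using t y by auto
    moreover have "(w + t) + (w + t) = w + w" using tt by (simp add: algebra_simps)
    ultimately have "\<exists>w'\<in>B. w' \<noteq> w \<and> w' + w' = w + w" by (intro bexI[of _ "w + t"]) auto
    moreover have "x \<noteq> w + t" using y t by (simp add: algebra_simps)
    ultimately show "x \<in> E \<and> b = x + t" using y t by (auto simp: E_def)
  qed
  moreover have "card E \<le> (if \<exists>w'\<in>B. w' \<noteq> w \<and> w' + w' = w + w then card B - 2 else 0)"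
  proof (cases "\<exists>w'\<in>B. w' \<noteq> w \<and> w' + w' = w + w")
    case True
    then obtain w' where w': "w' \<in> B" "w' \<noteq> w" "w' + w' = w + w" by blast
    have "(w' - w) + (w' - w) = 0" using w' by (simp add: algebra_simps)
    then have "w' - w = t" using t2[of "w' - w"] w' by auto
    then have "w' = w + t" by (simp add: algebra_simps)
    then have "w + t \<in> C" using w' by (simp add: C_def)
    then have "card (C - {w + t}) = card B - 2" using finC cC by simp
    then show ?thesis using True by (simp add: E_def)
  next
    case False
    then show ?thesis by (simp only: E_def False if_False card.empty le_refl)
  qed
  moreover have "(\<Sum>b\<in>C. card {x\<in>B. w + b - x \<in> B \<and> w + b - x \<noteq> x}) \<le> 2 * card C + card R"
  proof -
    have "(\<Sum>b\<in>C. card {x\<in>B. w + b - x \<in> B \<and> w + b - x \<noteq> x})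
      \<le> (\<Sum>b\<in>C. 2 + card {x. (b, x) \<in> R})"
    proof (rule sum_mono)
      fix b assume b: "b \<in> C"
      have finRb: "finite {x. (b, x) \<in> R}"
        by (rule finite_subset[OF _ finC]) (auto simp: R_def)
      \<comment> \<open>The elements \<open>w\<close> and \<open>b\<close> always qualify and
        account for the summand 2; any other \<open>x\<close> is a predecessor of \<open>b\<close>
        recorded in \<open>R\<close>.\<close>
      have "{x\<in>B. w + b - x \<in> B \<and> w + b - x \<noteq> x} \<subseteq> {w, b} \<union> {x. (b, x) \<in> R}"
        using b by (auto simp: R_def C_def)
      then have "card {x\<in>B. w + b - x \<in> B \<and> w + b - x \<noteq> x} \<le> card ({w, b} \<union> {x. (b, x) \<in> R})"
        using finRb by (intro card_mono) auto
      also have "\<dots> \<le> card {w, b} + card {x. (b, x) \<in> R}" by (rule card_Un_le)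
      also have "card {w, b} \<le> 2" by (simp add: card_insert_if)
      finally show "card {x\<in>B. w + b - x \<in> B \<and> w + b - x \<noteq> x} \<le> 2 + card {x. (b, x) \<in> R}"
        by simp
    qed
    also have "\<dots> = 2 * card C + (\<Sum>b\<in>C. card {x. (b, x) \<in> R})"
      unfolding sum.distrib by simp
    also have "(\<Sum>b\<in>C. card {x. (b, x) \<in> R}) = card (SIGMA b:C. {x. (b, x) \<in> R})"
    proof (subst card_SigmaI)
      show "\<forall>b\<in>C. finite {x. (b, x) \<in> R}"
        by (intro ballI finite_subset[OF _ finC]) (auto simp: R_def)
    qed (use finC in auto)
    also have "(SIGMA b:C. {x. (b, x) \<in> R}) = R" by (auto simp: R_def)
    finally show ?thesis .
  qed
  moreover have "2 * (2 * card C) + card C * (card C - 1) = (card B - 1) * (card B + 2)"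
  proof (cases "card C")
    case 0
    then show ?thesis using cC by simp
  next
    case (Suc k)
    then have "card B = k + 2" using cC by simp
    then show ?thesis using Suc by (simp add: algebra_simps)
  qed
  ultimately show ?thesis unfolding C_def[symmetric] by linarith
qed

section \<open>Numerical inequalities\<close>

text \<open>Cauchy-Schwarz bounds the sum of (p + q)^2 from below. The squares (q - p)^2 are bounded
  by (m - w)(q - p), whose sum is known exactly.\<close>

lemma sum_mult_lower_bound:
  fixes p q :: "'b \<Rightarrow> real"
  assumes fin: "finite S"
    and bd: "\<And>c. c \<in> S \<Longrightarrow> 0 \<le> q c - p c \<and> q c - p c \<le> m - w"
    and sp: "sum p S = w * M" and sq: "sum q S = m * M"
  shows "(m + w)^2 * M^2 \<le> real (card S) * ((m - w)^2 * M + 4 * (\<Sum>c\<in>S. p c * q c))"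
proof -
  have "((m + w) * M)^2 = (\<Sum>c\<in>S. 1 * (p c + q c))^2"
    by (simp add: sum.distrib sp sq algebra_simps)
  also have "\<dots> \<le> (\<Sum>c\<in>S. 1^2) * (\<Sum>c\<in>S. (p c + q c)^2)"
    by (rule Cauchy_Schwarz_ineq_sum)
  also have "\<dots> = real (card S) * (\<Sum>c\<in>S. (q c - p c)^2 + 4 * (p c * q c))"
    by (simp add: power2_eq_square algebra_simps)
  also have "\<dots> \<le> real (card S) * (\<Sum>c\<in>S. (m - w) * (q c - p c) + 4 * (p c * q c))"
    using bd by (intro mult_left_mono sum_mono add_right_mono)
      (auto simp: power2_eq_square intro!: mult_right_mono)
  also have "(\<Sum>c\<in>S. (m - w) * (q c - p c) + 4 * (p c * q c)) = (m - w)^2 * M + 4 * (\<Sum>c\<in>S. p c * q c)"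
    unfolding sum.distrib sum_distrib_left[symmetric] sum_subtractf sp sq
    by (simp add: power2_eq_square algebra_simps)
  finally show ?thesis by (simp add: power_mult_distrib)
qed

text \<open>The two polynomials are the values at \<open>w = M + 1 - g\<close> and \<open>w = M\<close> of the expression \<open>F\<close> in the
  next lemma, which is concave in \<open>w\<close>.\<close>

lemma endpoint_polynomials_pos:
  fixes M g :: int
  assumes g: "1 \<le> g" and M: "8 * g + 6 < 5 * M" and ex: "(M, g) \<noteq> (3, 1)"
  shows "0 < 2*M^4 - 4*g*M^3 + 2*g^2*M^2 - g^3*M + 6*g^2*M - 6*g*M^2 - 10*g*M + 4*g - 6*M^2 + 4*M" (is "0 < ?P")
    and "(M, g) \<noteq> (5, 2) \<Longrightarrow>
      0 < 2*M^4 - 2*M^3 - 2*g*M^3 - 10*g*M^2 + 3*g*M - 4*g^2*M + 4*g^2" (is "_ \<Longrightarrow> 0 < ?Q")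
proof -
  \<comment> \<open>For each small \<open>g\<close> the variable \<open>d\<close> is the distance of
    \<open>M\<close> from its least admissible value. All coefficients in \<open>d\<close> are then
    positive, except the constant term of \<open>?Q\<close> for g = 2, which is why (5, 2) is
    excluded there.\<close>
  have small: "g \<in> {1,2,3,4,5,6} \<Longrightarrow> 0 < ?P \<and> ((M, g) \<noteq> (5, 2) \<longrightarrow> 0 < ?Q)"
  proof -
    assume "g \<in> {1,2,3,4,5,6}"
    then consider "g = 1" | "g = 2" | "g = 3" | "g = 4" | "g = 5" | "g = 6" by blast
    then show ?thesis
    proof cases
      case 1
      define d where "d = M - 4"
      have d: "0 \<le> d" "M = d + 4" using 1 M ex by (auto simp: d_def)
      have "?P = 2*d^4 + 28*d^3 + 134*d^2 + 239*d + 96" "?Q = 2*d^4 + 28*d^3 + 134*d^2 + 239*d + 96"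
        using d(2) 1 by algebra+
      then show ?thesis using d(1) by (auto intro!: add_nonneg_pos add_nonneg_nonneg)
    next
      case 2
      define d where "d = M - 5"
      have d: "0 \<le> d" "M = d + 5" using 2 M by (auto simp: d_def)
      have P: "?P = 2*d^4 + 32*d^3 + 170*d^2 + 300*d + 8" and Q: "?Q = 2*d^4 + 34*d^3 + 190*d^2 + 340*d - 34"
        using d(2) 2 by algebra+
      have "0 < ?Q" if "M \<noteq> 5"
      proof -
        have "d \<ge> 1" using that d by auto
        moreover have "0 \<le> 2*d^4 + 34*d^3 + 190*d^2" using d by simp
        ultimately show ?thesis using Q by linarith
      qed
      moreover have "0 < ?P" unfolding P using d(1) by (intro add_nonneg_pos add_nonneg_nonneg) auto
      ultimately show ?thesis using 2 unfolding prod.inject by blast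
    next
      case 3
      define d where "d = M - 7"
      have d: "0 \<le> d" "M = d + 7" using 3 M by (auto simp: d_def)
      have "?P = 2*d^4 + 44*d^3 + 330*d^2 + 897*d + 411" "?Q = 2*d^4 + 48*d^3 + 390*d^2 + 1121*d + 435"
        using d(2) 3 by algebra+
      then show ?thesis using d(1) by (auto intro!: add_nonneg_pos add_nonneg_nonneg)
    next
      case 4
      define d where "d = M - 8"
      have d: "0 \<le> d" "M = d + 8" using 4 M by (auto simp: d_def)
      have "?P = 2*d^4 + 48*d^3 + 386*d^2 + 1052*d + 112" "?Q = 2*d^4 + 54*d^3 + 488*d^2 + 1484*d + 160"
        using d(2) 4 by algebra+
      then show ?thesis using d(1) by (auto intro!: add_nonneg_pos add_nonneg_nonneg)
    next
      case 5
      define d where "d = M - 10"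
      have d: "0 \<le> d" "M = d + 10" using 5 M by (auto simp: d_def)
      have "?P = 2*d^4 + 60*d^3 + 614*d^2 + 2259*d + 1210" "?Q = 2*d^4 + 68*d^3 + 790*d^2 + 3315*d + 2250"
        using d(2) 5 by algebra+
      then show ?thesis using d(1) by (auto intro!: add_nonneg_pos add_nonneg_nonneg)
    next
      case 6
      define d where "d = M - 11"
      have d: "0 \<le> d" "M = d + 11" using 6 M by (auto simp: d_def)
      have "?P = 2*d^4 + 64*d^3 + 690*d^2 + 2540*d + 376" "?Q = 2*d^4 + 74*d^3 + 930*d^2 + 4120*d + 2146"
        using d(2) 6 by algebra+
      then show ?thesis using d(1) by (auto intro!: add_nonneg_pos add_nonneg_nonneg)
    qed
  qed
  have large: "7 \<le> g \<Longrightarrow> 0 < ?P \<and> 0 < ?Q"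
  proof -
    assume "7 \<le> g"
    define k where "k = g - 7"
    \<comment> \<open>By integrality the hypothesis reads \<open>8 * g + 7 \<le> 5 * M\<close>, and
      \<open>d\<close> is its slack. The factor 625 = 5^4 clears the denominators of a quartic in
      \<open>M\<close>; the shifts by 7 and 5 in \<open>k\<close> and \<open>j\<close> make all
      coefficients positive.\<close>
    define d where "d = 5 * M - 8 * g - 7"
    have kd: "0 \<le> k" "0 \<le> d" "g = k + 7" "5 * M = 8 * g + 7 + d"
      using \<open>7 \<le> g\<close> M by (auto simp: k_def d_def)
    have "625 * ?P = 152*k^4 + 931*k^3*d + 7173*k^3 + 338*k^2*d^2 + 22633*k^2*d + 91357*k^2 + 44*k*d^3
        + 5506*k*d^2 + 180723*k*d + 421803*k + 2*d^4 + 364*d^3 + 22418*d^2 + 476521*d + 572467"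
      using kd(3,4) by algebra
    moreover have "0 < \<dots>" using kd(1,2) by (intro add_nonneg_pos add_nonneg_nonneg) auto
    ultimately have "0 < 625 * ?P" by (simp only:)
    then have P: "0 < ?P" by (rule zero_less_mult_pos) simp
    define j where "j = g - 5"
    have j: "0 \<le> j" "g = j + 5" using \<open>7 \<le> g\<close> by (auto simp: j_def)
    have "625 * ?Q = 3072*j^4 + 2176*j^3*d + 51552*j^3 + 528*j^2*d^2 + 33612*j^2*d + 298912*j^2 + 54*j*d^3
        + 5924*j*d^2 + 174373*j*d + 655857*j + 2*d^4 + 316*d^3 + 16798*d^2 + 304839*d + 331857"
      using j(2) kd(4) by algebra
    moreover have "0 < \<dots>" using kd(2) j(1) by (intro add_nonneg_pos add_nonneg_nonneg) auto
    ultimately have "0 < 625 * ?Q" by (simp only:)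
    then have "0 < ?Q" by (rule zero_less_mult_pos) simp
    then show ?thesis using P by blast
  qed
  have "g \<in> {1,2,3,4,5,6} \<or> 7 \<le> g" using g by auto
  then show "0 < ?P" "(M, g) \<noteq> (5, 2) \<Longrightarrow> 0 < ?Q" using small large by blast+
qed

text \<open>With \<open>e\<close> replaced by the weaker of its bounds, the difference of the two
  sides of \<open>ineq\<close> is concave in \<open>w\<close>, so positivity at both ends of the
  range of \<open>w\<close> refutes it. The pair (5, 2) needs the sharper bound on \<open>e\<close>;
  the pair (3, 1) survives.\<close>

lemma endpoint_contradiction:
  fixes M g w e :: int
  assumes M: "8 * g + 6 < 5 * M" and w: "M + 1 - g \<le> w" "w \<le> M"
    and ineq: "(M + 1 + w)^2 * M^2 \<le> (M + g) * ((M + 1 - w)^2 * M + 2 * w * M * (M + 3) + 2 * e * (M - 1))"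
    and e: "e \<le> 2 * (w + g - M - 1) \<or> (e = w \<and> even w \<and> e \<le> 2 * (w + g - M))"
  shows "M = 3 \<and> g = 1"
proof (rule ccontr)
  assume ex: "\<not> (M = 3 \<and> g = 1)"
  have g: "1 \<le> g" using w by linarith
  have M4: "3 \<le> M" using M g by linarith
  define P where "P = 2*M^4 - 4*g*M^3 + 2*g^2*M^2 - g^3*M + 6*g^2*M - 6*g*M^2 - 10*g*M + 4*g - 6*M^2 + 4*M"
  define Q where "Q = 2*M^4 - 2*M^3 - 2*g*M^3 - 10*g*M^2 + 3*g*M - 4*g^2*M + 4*g^2"
  have P: "0 < P" unfolding P_def using endpoint_polynomials_pos(1)[OF g M] ex by auto
  have e': "e \<le> 2 * (w + g - M)" using e by auto
  define F where "F = (M + 1 + w)^2 * M^2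
    - (M + g) * ((M + 1 - w)^2 * M + 2 * w * M * (M + 3) + 2 * (2 * (w + g - M)) * (M - 1))"
  have F: "F \<le> 0"
  proof -
    have "2 * e * (M - 1) \<le> 2 * (2 * (w + g - M)) * (M - 1)"
      using e' M4 by (intro mult_right_mono) auto
    then have "(M + g) * ((M + 1 - w)^2 * M + 2 * w * M * (M + 3) + 2 * e * (M - 1))
      \<le> (M + g) * ((M + 1 - w)^2 * M + 2 * w * M * (M + 3) + 2 * (2 * (w + g - M)) * (M - 1))"
      using M4 g by (intro mult_left_mono) auto
    then show ?thesis using ineq unfolding F_def by linarith
  qed
  show False
  proof (cases "w = M + 1 - g")
    case True
    have "F = P" using True unfolding F_def P_def by algebra
    then show False using F P by simp
  next
    case False
    then have g2: "g > 1" "w - (M + 1 - g) > 0" using w by auto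
    \<comment> \<open>Lagrange interpolation of the quadratic \<open>F\<close> at the two endpoints,
      which are \<open>g - 1\<close> apart; the last term reflects the leading coefficient - g *
      M.\<close>
    have id: "(g - 1) * F = (M - w) * P + (w - (M + 1 - g)) * Q + g * M * (w - (M + 1 - g)) * (M - w) * (g - 1)"
      unfolding F_def P_def Q_def by algebra
    show False
    proof (cases "(M, g) = (5, 2)")
      case True
      \<comment> \<open>As \<open>w = 5\<close> is odd, the second alternative for \<open>e\<close>
        is impossible. Even for e = 2 the inequality would read 3025 \<le> 2947.\<close>
      then have M5: "M = 5" "g = 2" "w = 5" using g2 w by auto
      then have "e \<le> 2" using e by auto
      then show False using ineq M5 by simp
    next
      case False
      then have Q: "0 < Q" unfolding Q_def using endpoint_polynomials_pos(2)[OF g M] ex by auto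
      have "0 \<le> (M - w) * P" "0 < (w - (M + 1 - g)) * Q" "0 \<le> g * M * (w - (M + 1 - g)) * (M - w) * (g - 1)"
        using P Q w g2 M4 by auto
      then have "0 < (g - 1) * F" using id by linarith
      then show False using F g2 by (simp add: zero_less_mult_iff)
    qed
  qed
qed

text \<open>Excludes the surviving pair M = 3, g = 1. However the pairwise sums fall among the four
  elements, two relations combine to an element of order 2, as in the cyclic and the Klein group of
  order 4.\<close>

lemma no_four_element_case:
  fixes B :: "'a::ab_group_add set"
  assumes "0 \<in> B" "card B = 4" "rsum B \<subseteq> B" "\<And>x. x \<in> B - {0} \<Longrightarrow> x + x \<noteq> 0"
  shows False
proof -
  have "card (B - {0}) = 3" using assms(1,2) by simp
  then obtain x y z where xyz: "B - {0} = {x, y, z}" "x \<noteq> y" "x \<noteq> z" "y \<noteq> z"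
    unfolding card_3_iff by blast
  have nz: "x \<noteq> 0" "y \<noteq> 0" "z \<noteq> 0" and B: "B = {0, x, y, z}" using xyz(1) assms(1) by auto
  have d: "x + x \<noteq> 0" "y + y \<noteq> 0" "z + z \<noteq> 0" using assms(4) xyz(1) by auto
  have "x + y \<in> rsum B" "x + z \<in> rsum B" "y + z \<in> rsum B"
    using xyz(2-4) by (auto intro!: rsumI simp: B)
  then have "x + y \<in> B" "x + z \<in> B" "y + z \<in> B" using assms(3) by blast+
  then have s: "x + y = 0 \<or> x + y = z" "x + z = 0 \<or> x + z = y" "y + z = 0 \<or> y + z = x"
    using nz unfolding B by auto
  show False
  proof (cases "x + y = 0")
    case True
    have "x + z \<noteq> 0" "y + z \<noteq> 0" using True xyz(3,4) by (metis add_left_cancel add.commute)+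
    then have "x + z = y" "y + z = x" using s by auto
    then have "z + z = 0" by (metis add.assoc add_cancel_left_right)
    then show False using d by simp
  next
    case False
    then have 1: "x + y = z" using s by simp
    show False
    proof (cases "x + z = 0")
      case True
      have "y + z \<noteq> 0" using True xyz(2) by (metis add_right_cancel)
      then have "y + z = x" using s by simp
      then have "y + y = 0" using 1 by (metis add.assoc add.left_commute add_cancel_left_right)
      then show False using d by simp
    next
      case False
      then have "x + z = y" using s by simp
      then have "x + x = 0" using 1 by (metis add.assoc add_cancel_left_left)
      then show False using d by simp
    qed
  qed
qed

section \<open>The golden ratio bound in groups with at most one element of order 2\<close>

text \<open>The equation inverts \<open>golden - 1\<close>; the rational bound then turns the
  resulting estimate into an inequality between integers.\<close>

lemma golden_root: "golden * (golden - 1) = 1" "8 / 5 < golden"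
proof -
  show "golden * (golden - 1) = 1" by (simp add: golden_def field_simps)
  have "11 / 5 < sqrt 5" by (rule real_less_rsqrt) (simp add: power2_eq_square)
  then show "8 / 5 < golden" by (simp add: golden_def)
qed

theorem card_rsum_golden:
  fixes B :: "'a::ab_group_add set"
  assumes fin: "finite B" and zB: "0 \<in> B" and B3: "3 \<le> card B"
    and t2: "\<And>x::'a. x + x = 0 \<Longrightarrow> x = 0 \<or> x = t"
    and w0: "w0 \<in> B" "w0 + w0 \<notin> insert 0 (rsum B)"
  shows "golden * (real (card B) + 1) - 4 \<le> real (card (insert 0 (rsum B)))"
proof (rule ccontr)
  assume small: "\<not> ?thesis"
  define S where "S = insert 0 (rsum B)"
  define W where "W = {w\<in>B. w + w \<notin> S}"
  \<comment> \<open>Elements with the same double differ by \<open>t\<close>, so \<open>W2\<close>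
    falls into pairs sharing a double. Such a double has two representations instead of one, but the
    pair contributes only one new element to \<open>B + B\<close>; hence the separate count.\<close>
  define W2 where "W2 = {w\<in>W. \<exists>w'\<in>B. w' \<noteq> w \<and> w' + w' = w + w}"
  define dbl where "dbl = (\<lambda>x::'a. x + x)"
  define M where "M = card B - 1"
  have M: "card B = M + 1" "2 \<le> M" using B3 by (auto simp: M_def)
  have finS: "finite S" and finW: "finite W" and finW2: "finite W2"
    using fin finite_rsum by (auto simp: S_def W_def W2_def)
  have WB: "W \<subseteq> B - {0}" by (auto simp: W_def S_def)
  have WB': "W \<subseteq> B" using WB by auto
  have W2W: "W2 \<subseteq> W" by (auto simp: W2_def)
  have BS: "B \<subseteq> S" unfolding S_def using zB by (rule subset_insert_rsum)
  define p where "p c = card {x\<in>W. c - x \<in> B \<and> c - x \<noteq> x}" for c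
  define q where "q c = card {x\<in>B. c - x \<in> B \<and> c - x \<noteq> x}" for c
  have sub: "rsum B \<subseteq> S" by (auto simp: S_def)
  have sp: "(\<Sum>c\<in>S. p c) = card W * M"
  proof -
    have "(\<Sum>c\<in>S. p c * 1) = (\<Sum>x\<in>W. \<Sum>b\<in>B - {x}. 1)"
      unfolding p_def using sum_rsum_reindex[OF fin _ finS sub, of W "\<lambda>_. 1"] WB' by simp
    also have "\<dots> = (\<Sum>x\<in>W. M)" using WB fin M by (intro sum.cong) auto
    finally show ?thesis by simp
  qed
  have sq: "(\<Sum>c\<in>S. q c) = card B * M"
  proof -
    have "(\<Sum>c\<in>S. q c * 1) = (\<Sum>x\<in>B. \<Sum>b\<in>B - {x}. 1)"
      unfolding q_def using sum_rsum_reindex[OF fin _ finS sub, of B "\<lambda>_. 1"] by simp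
    also have "\<dots> = (\<Sum>x\<in>B. M)" using fin M by (intro sum.cong) auto
    finally show ?thesis by simp
  qed
  have spq: "2 * (\<Sum>c\<in>S. p c * q c) \<le> card W * (M * (M + 3)) + card W2 * (M - 1)"
  proof -
    have "2 * (\<Sum>c\<in>S. p c * q c) = (\<Sum>x\<in>W. 2 * (\<Sum>b\<in>B - {x}. q (x + b)))"
      unfolding p_def using sum_rsum_reindex[OF fin _ finS sub, of W q] WB'
      by (simp flip: sum_distrib_left)
    also have "\<dots> \<le> (\<Sum>x\<in>W. M * (M + 3) + (if x \<in> W2 then M - 1 else 0))"
    proof (rule sum_mono)
      fix x assume x: "x \<in> W"
      then have "x \<in> B" "x + x \<notin> rsum B" by (auto simp: W_def S_def)
      note triples = card_triples_le[OF fin this t2]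
      have "(card B - 1) * (card B + 2) = M * (M + 3)" "card B - 2 = M - 1"
        using M by (auto simp: algebra_simps)
      moreover have "(\<exists>w'\<in>B. w' \<noteq> x \<and> w' + w' = x + x) \<longleftrightarrow> x \<in> W2" using x by (simp add: W2_def)
      ultimately show "2 * (\<Sum>b\<in>B - {x}. q (x + b)) \<le> M * (M + 3) + (if x \<in> W2 then M - 1 else 0)"
        using triples by (simp only: q_def)
    qed
    also have "\<dots> = card W * (M * (M + 3)) + card W2 * (M - 1)"
      using finW W2W by (simp add: sum.distrib sum.If_cases Int_absorb1)
    finally show ?thesis .
  qed
  have bd: "0 \<le> real (q c) - real (p c) \<and> real (q c) - real (p c) \<le> real (card B) - real (card W)" for c
  proof -
    have "q c = p c + card {x\<in>B - W. c - x \<in> B \<and> c - x \<noteq> x}"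
      unfolding p_def q_def using fin finW WB
      by (subst card_Un_disjoint[symmetric]) (auto intro!: arg_cong[of _ _ card])
    moreover have "card {x\<in>B - W. c - x \<in> B \<and> c - x \<noteq> x} \<le> card (B - W)"
      using fin by (intro card_mono) auto
    moreover have "card (B - W) = card B - card W" "card W \<le> card B"
      using fin finW WB by (auto intro: card_Diff_subset card_mono)
    ultimately show ?thesis by simp
  qed
  have ineq_real: "(real (card B) + real (card W))^2 * real M^2 \<le> real (card S) *
    ((real (card B) - real (card W))^2 * real M + 4 * (\<Sum>c\<in>S. real (p c) * real (q c)))"
    using sp sq by (intro sum_mult_lower_bound[OF finS bd]) (simp_all flip: of_nat_sum of_nat_mult)
  define g where "g = int (card S) - int M"
  define w where "w = int (card W)"
  define e where "e = int (card W2)"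
  have cS: "int (card S) = int M + g" by (simp add: g_def)
  have ineq: "(int M + 1 + w)^2 * int M^2 \<le> (int M + g) *
    ((int M + 1 - w)^2 * int M + 2 * w * int M * (int M + 3) + 2 * e * (int M - 1))"
  proof -
    have "real (card S) * ((real (card B) - real (card W))^2 * real M + 4 * (\<Sum>c\<in>S. real (p c) * real (q c)))
      \<le> real (card S) * ((real (card B) - real (card W))^2 * real M
          + 2 * (real (card W) * (real M * (real M + 3)) + real (card W2) * (real M - 1)))"
    proof -
      have "real (2 * (\<Sum>c\<in>S. p c * q c)) \<le> real (card W * (M * (M + 3)) + card W2 * (M - 1))"
        using spq by (rule of_nat_mono)
      then have "2 * (\<Sum>c\<in>S. real (p c) * real (q c))
        \<le> real (card W) * (real M * (real M + 3)) + real (card W2) * (real M - 1)"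
        using M by (simp add: of_nat_diff)
      then show ?thesis by (intro mult_left_mono add_left_mono) auto
    qed
    with ineq_real have "(real (card B) + real (card W))^2 * real M^2 \<le> real (card S) *
      ((real (card B) - real (card W))^2 * real M
          + 2 * (real (card W) * (real M * (real M + 3)) + real (card W2) * (real M - 1)))" by linarith
    then have "real_of_int ((int M + 1 + w)^2 * int M^2) \<le> real_of_int ((int (card S)) *
      ((int M + 1 - w)^2 * int M + 2 * w * int M * (int M + 3) + 2 * e * (int M - 1)))"
      using M by (simp add: w_def e_def algebra_simps)
    then show ?thesis unfolding cS by (simp only: of_int_le_iff)
  qed
  have fibre: "{z\<in>B. z + z = w + w} = {w, w'}"
    if "w \<in> B" "w' \<in> B" "w' \<noteq> w" "w' + w' = w + w" for w w'
  proof -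
    have eq: "z = w + t" if "z \<noteq> w" "z + z = w + w" for z
    proof -
      have "(z - w) + (z - w) = 0" using that by (simp add: algebra_simps)
      then have "z - w = t" using t2[of "z - w"] that by auto
      then show ?thesis by (simp add: algebra_simps)
    qed
    then show ?thesis using that by (auto; metis)
  qed
  have e_dbl: "card W2 = 2 * card (dbl ` W2)"
  proof -
    have "card {z\<in>W2. dbl z = y} = 2" if y: "y \<in> dbl ` W2" for y
    proof -
      obtain w where w: "w \<in> W2" "y = w + w" using y by (auto simp: dbl_def)
      then obtain w' where w': "w' \<in> B" "w' \<noteq> w" "w' + w' = w + w" by (auto simp: W2_def)
      have wB: "w \<in> B" "w + w \<notin> S" using w by (auto simp: W2_def W_def)
      have "{z\<in>W2. dbl z = y} = {z\<in>B. z + z = w + w}"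
        using fibre[OF wB(1) w'] w w' wB by (auto simp: W2_def W_def dbl_def)
      then show ?thesis using fibre[OF wB(1) w'] w' by simp
    qed
    moreover have "card W2 = (\<Sum>y\<in>dbl ` W2. card {z\<in>W2. dbl z = y})"
      using finW2 by (subst card_eq_sum, subst sum.image_gen[of W2 _ dbl]) auto
    ultimately show ?thesis by simp
  qed
  define D where "D = card (B + B)"
  have BB: "D \<le> card S + card (dbl ` (W - W2)) + card (dbl ` W2)"
  proof -
    have "B + B \<subseteq> S \<union> dbl ` (W - W2) \<union> dbl ` W2"
    proof
      fix z assume "z \<in> B + B"
      then obtain x y where xy: "z = x + y" "x \<in> B" "y \<in> B" by (rule set_plus_elim)
      show "z \<in> S \<union> dbl ` (W - W2) \<union> dbl ` W2"
      proof (cases "x = y")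
        case True
        then show ?thesis using xy by (auto simp: W_def dbl_def)
      next
        case False
        then show ?thesis using xy rsumI[of x B y] by (simp add: S_def)
      qed
    qed
    then have "card (B + B) \<le> card (S \<union> dbl ` (W - W2) \<union> dbl ` W2)"
      using finS finW finW2 by (intro card_mono) auto
    also have "\<dots> \<le> card (S \<union> dbl ` (W - W2)) + card (dbl ` W2)" by (rule card_Un_le)
    also have "card (S \<union> dbl ` (W - W2)) \<le> card S + card (dbl ` (W - W2))" by (rule card_Un_le)
    finally show ?thesis by (simp add: D_def)
  qed
  have W1: "card (dbl ` (W - W2)) \<le> card W - card W2"
    using card_image_le[of "W - W2" dbl] finW finW2 W2W by (simp add: card_Diff_subset)
  have W2le: "card W2 \<le> card W" using finW W2W by (rule card_mono)
  have reps: "{x\<in>B. v + v - x \<in> B} = {z\<in>B. z + z = v + v}" if v: "v \<in> W" for v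
  proof -
    have "x + x = v + v" if "x \<in> B" "v + v - x \<in> B" for x
    proof (rule ccontr)
      assume "x + x \<noteq> v + v"
      then have "x \<noteq> v + v - x" by (metis diff_add_cancel)
      then have "x + (v + v - x) \<in> rsum B" using that by (intro rsumI)
      then show False using v by (simp add: W_def S_def)
    qed
    moreover have "v + v - x \<in> B" if "x \<in> B" "x + x = v + v" for x
      using that by (metis add_diff_cancel_right')
    ultimately show ?thesis by blast
  qed
  have inBB: "v + v \<in> B + B" if "v \<in> W" for v using that by (auto simp: W_def)
  have w0W: "w0 \<in> W" using w0 by (simp add: W_def S_def)
  \<comment> \<open>Kemperman-Scherk is applied to a double outside \<open>S\<close>, which has one
    representation if some element of \<open>W\<close> is not in \<open>W2\<close>, and two
    otherwise. In the latter case the pairing makes \<open>w\<close> even.\<close>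
  have caseAB: "e \<le> 2 * (w + g - int M - 1) \<or> (e = w \<and> even w \<and> e \<le> 2 * (w + g - int M))"
  proof (cases "W = W2")
    case True
    then obtain w' where w': "w' \<in> B" "w' \<noteq> w0" "w' + w' = w0 + w0" using w0W by (auto simp: W2_def)
    have "card {x\<in>B. w0 + w0 - x \<in> B} = 2"
      using reps[OF w0W] fibre[OF w0(1) w'] w' by simp
    then have "2 * card B \<le> D + 2" using Kemperman_Scherk[OF fin inBB[OF w0W]] by (simp add: D_def)
    moreover have "D \<le> card S + card (dbl ` W2)" using BB True by simp
    ultimately have "2 * (M + 1) \<le> card S + card (dbl ` W2) + 2" unfolding M(1) by linarith
    then have "4 * int M \<le> 2 * int (card S) + int (card W2)" unfolding e_dbl by simp
    moreover have "e = w" "even w" using True e_dbl by (auto simp: e_def w_def)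
    ultimately show ?thesis using cS by (simp add: e_def w_def)
  next
    case False
    then obtain v where v: "v \<in> W" "v \<notin> W2" using W2W by blast
    have "{x\<in>B. v + v - x \<in> B} \<subseteq> {v}" using reps[OF v(1)] v by (auto simp: W2_def W_def)
    then have "card {x\<in>B. v + v - x \<in> B} \<le> 1" using card_mono[of "{v}"] by fastforce
    then have "2 * card B \<le> D + 1" using Kemperman_Scherk[OF fin inBB[OF v(1)]] by (simp add: D_def)
    then have "2 * (M + 1) \<le> card S + (card W - card W2) + card (dbl ` W2) + 1" using BB W1 unfolding M(1) by linarith
    then have "4 * int M + 2 \<le> 2 * int (card S) + 2 * int (card W) - int (card W2)"
      using W2le unfolding e_dbl by simp
    then show ?thesis using cS by (simp add: e_def w_def)
  qed
  have "card W \<le> card (B - {0})" using fin WB by (intro card_mono) auto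
  then have wM: "w \<le> int M" using fin zB M by (simp add: w_def)
  have w1: "1 \<le> w" using w0W finW by (auto simp: w_def Suc_le_eq card_gt_0_iff)
  \<comment> \<open>The first alternative suffices because \<open>e\<close> is nonnegative. In the
    second, w = 2k with k \<ge> 1, and the bound gives M - g \<le> k \<le> w - 1.\<close>
  have wlow: "int M + 1 - g \<le> w"
  proof (cases "e \<le> 2 * (w + g - int M - 1)")
    case True
    then show ?thesis by (simp add: e_def)
  next
    case False
    then have *: "e = w" "even w" "e \<le> 2 * (w + g - int M)" using caseAB by auto
    then obtain k where "w = 2 * k" by auto
    then show ?thesis using * w1 by presburger
  qed
  have M8: "8 * g + 6 < 5 * int M"
  proof -
    have "real_of_int g + real M < golden * (real M + 2) - 4"
      using small M by (simp add: S_def[symmetric] g_def add.commute not_le)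
    \<comment> \<open>The constant 4 of the claim makes its negation homogeneous in g + 2 and M + 2;
      multiplication by \<open>golden\<close> then removes the factor
      \<open>golden - 1\<close>.\<close>
    then have "real_of_int g + 2 < (golden - 1) * (real M + 2)" by (simp add: algebra_simps)
    then have "golden * (real_of_int g + 2) < golden * ((golden - 1) * (real M + 2))"
      using golden_root by (intro mult_strict_left_mono) auto
    then have 1: "golden * (real_of_int g + 2) < real M + 2"
      using golden_root(1) by (simp flip: mult.assoc)
    have "0 \<le> g + 2" using wlow wM by linarith
    then have "8 / 5 * (real_of_int g + 2) \<le> golden * (real_of_int g + 2)"
      using golden_root(2) by (intro mult_right_mono) linarith+
    then have "8 / 5 * (real_of_int g + 2) < real M + 2" using 1 by (rule le_less_trans)
    then have "8 * real_of_int g + 6 < 5 * real M" by (simp add: field_simps)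
    then have "real_of_int (8 * g + 6) < real_of_int (5 * int M)" by simp
    then show ?thesis by (simp only: of_int_less_iff)
  qed
  \<comment> \<open>The surviving pair forces \<open>S = B\<close> and \<open>W = B - {0}\<close>,
    so \<open>B\<close> is closed under sums of distinct elements and has no element of order
    2.\<close>
  have Mg: "int M = 3 \<and> g = 1"
    by (rule endpoint_contradiction[OF M8 wlow wM ineq caseAB])
  then have "card B = card S" using M cS by simp
  then have "B = S" using BS finS by (simp add: card_subset_eq)
  have "W = B - {0}"
    using Mg wlow wM M fin zB WB by (intro card_subset_eq) (auto simp: w_def)
  show False
  proof (rule no_four_element_case[OF zB])
    show "card B = 4" using Mg M by simp
    show "rsum B \<subseteq> B" using sub \<open>B = S\<close> by simp
    show "x + x \<noteq> 0" if "x \<in> B - {0}" for x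
    proof -
      have "x \<in> W" using that \<open>W = B - {0}\<close> by simp
      then show ?thesis by (auto simp: W_def S_def)
    qed
  qed
qed

section \<open>Sets of integers modulo their maximum\<close>

text \<open>The residues modulo \<open>l\<close> are realised inside the single type of rationals modulo 1, because
  \<open>l\<close> is a variable and Kneser's theorem is stated for types.\<close>

quotient_type qz = rat / "\<lambda>x y. x - y \<in> \<int>"
proof (rule equivpI)
  show "reflp (\<lambda>x y::rat. x - y \<in> \<int>)" by (simp add: reflp_def)
  show "symp (\<lambda>x y::rat. x - y \<in> \<int>)"
  proof (rule sympI)
    fix x y :: rat assume "x - y \<in> \<int>"
    then have "- (x - y) \<in> \<int>" by (rule Ints_minus)
    then show "y - x \<in> \<int>" by simp
  qed
  show "transp (\<lambda>x y::rat. x - y \<in> \<int>)"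
  proof (rule transpI)
    fix x y z :: rat assume "x - y \<in> \<int>" "y - z \<in> \<int>"
    then have "(x - y) + (y - z) \<in> \<int>" by (rule Ints_add)
    then show "x - z \<in> \<int>" by simp
  qed
qed

instantiation qz :: ab_group_add
begin

lift_definition zero_qz :: qz is 0 .

lift_definition plus_qz :: "qz \<Rightarrow> qz \<Rightarrow> qz" is "(+)"
proof -
  fix a b c d :: rat assume "a - b \<in> \<int>" "c - d \<in> \<int>"
  then have "(a - b) + (c - d) \<in> \<int>" by (rule Ints_add)
  then show "(a + c) - (b + d) \<in> \<int>" by (simp add: algebra_simps)
qed

lift_definition uminus_qz :: "qz \<Rightarrow> qz" is uminus
proof -
  fix a b :: rat assume "a - b \<in> \<int>"
  then have "- (a - b) \<in> \<int>" by (rule Ints_minus)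
  then show "- a - - b \<in> \<int>" by simp
qed

definition minus_qz :: "qz \<Rightarrow> qz \<Rightarrow> qz" where "minus_qz x y = x + - y"

instance
proof
  fix a b c :: qz
  show "a + b + c = a + (b + c)" by transfer (simp add: add.assoc)
  show "a + b = b + a" by transfer (simp add: add.commute)
  show "0 + a = a" by transfer simp
  show "- a + a = 0" by transfer simp
  show "a - b = a + - b" by (rule minus_qz_def)
qed

end

text \<open>For positive \<open>l\<close> this is reduction modulo \<open>l\<close>, the residue of
  x being the class of the fraction x / l.\<close>

lift_definition qz_of :: "int \<Rightarrow> int \<Rightarrow> qz" is "\<lambda>l x. of_int x / of_int l" .

lemma qz_of_add: "qz_of l (x + y) = qz_of l x + qz_of l y"
  by transfer (simp add: add_divide_distrib)

lemma qz_of_eq_iff: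
  assumes "l > 0"
  shows "qz_of l x = qz_of l y \<longleftrightarrow> l dvd x - y"
  using assms
proof (transfer)
  fix l x y :: int assume l: "l > 0"
  show "(of_int x / of_int l - of_int y / of_int l :: rat) \<in> \<int> \<longleftrightarrow> l dvd x - y"
  proof
    assume "(of_int x / of_int l - of_int y / of_int l :: rat) \<in> \<int>"
    then obtain k where "(of_int x / of_int l - of_int y / of_int l :: rat) = of_int k" by (rule Ints_cases)
    then have "(of_int (x - y) :: rat) = of_int (l * k)" using l by (simp add: field_simps)
    then have "x - y = l * k" by (simp only: of_int_eq_iff)
    then show "l dvd x - y" by simp
  next
    assume "l dvd x - y"
    then obtain k where "x - y = l * k" by blast
    then have "x = y + l * k" by simp
    then have "(of_int x / of_int l - of_int y / of_int l :: rat) = of_int k"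
      using l by (simp add: field_simps)
    then show "(of_int x / of_int l - of_int y / of_int l :: rat) \<in> \<int>" by simp
  qed
qed

lift_definition qz_half :: qz is "1 / 2" .

lemma qz_two_torsion: "x + x = 0 \<Longrightarrow> x = 0 \<or> x = qz_half"
proof transfer
  fix x :: rat assume "x + x - 0 \<in> \<int>"
  then obtain k where k: "x + x = of_int k" by (auto elim: Ints_cases)
  show "x - 0 \<in> \<int> \<or> x - 1 / 2 \<in> \<int>"
  proof (cases "even k")
    case True
    then obtain j where "k = 2 * j" by blast
    then have "x = of_int j" using k by simp
    then show ?thesis by simp
  next
    case False
    then obtain j where "k = 2 * j + 1" by (rule oddE)
    then have "x - 1 / 2 = of_int j" using k by simp
    then show ?thesis by simp
  qed
qed

section \<open>Integer sumsets, coset partitions and subgroups\<close>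

text \<open>A period of a finite set of integers cannot raise its maximum, nor can its negative, so
  the stabilizer in Kneser's inequality is trivial.\<close>

lemma card_sumset_int:
  fixes A B :: "int set"
  assumes "finite A" "finite B" "A \<noteq> {}" "B \<noteq> {}"
  shows "card A + card B \<le> card (A + B) + 1"
proof -
  have fin: "finite (A + B)" using assms by (simp add: finite_set_plus)
  have ne: "A + B \<noteq> {}" using assms by (auto simp: set_plus_def)
  have le: "g \<le> 0" if "g \<in> stab (A + B)" for g
    using Max_ge[OF fin stabD[OF that Max_in[OF fin ne]]] by simp
  have "stab (A + B) = {0}"
  proof (intro equalityI subsetI)
    fix g assume "g \<in> stab (A + B)"
    then have "g \<le> 0" "- g \<le> 0" using le stab_uminus by blast+
    then show "g \<in> {0}" by simp
  qed simp
  then show ?thesis using Kneser_weak[OF assms] by simp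
qed

text \<open>The sums involving the minimum and those involving the maximum have only m + t in
  common.\<close>

lemma card_rsum_int:
  fixes A :: "int set"
  assumes fin: "finite A"
  shows "2 * card A \<le> card (rsum A) + 3"
proof (cases "A = {}")
  case False
  define m where "m = Min A"
  define t where "t = Max A"
  have mt: "m \<in> A" "t \<in> A" "\<And>a. a \<in> A \<Longrightarrow> m \<le> a \<and> a \<le> t"
    using fin False by (auto simp: m_def t_def)
  define P where "P = (+) m ` (A - {m})"
  define Q where "Q = (+) t ` (A - {t})"
  have fPQ: "finite P" "finite Q" using fin by (auto simp: P_def Q_def)
  have c: "card P = card A - 1" "card Q = card A - 1" unfolding P_def Q_def card_translate using fin mt by auto
  have "P \<inter> Q \<subseteq> {m + t}"
  proof
    fix x assume "x \<in> P \<inter> Q"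
    then have "x \<in> (+) m ` A" "x \<in> (+) t ` A" by (auto simp: P_def Q_def)
    then obtain a b where ab: "a \<in> A" "b \<in> A" "x = m + a" "x = t + b" by blast
    then have "m \<le> b" "a \<le> t" using mt by auto
    then show "x \<in> {m + t}" using ab by simp
  qed
  then have "card (P \<inter> Q) \<le> 1" using card_mono[of "{m + t}" "P \<inter> Q"] by simp
  moreover have "card P + card Q = card (P \<union> Q) + card (P \<inter> Q)" using fPQ by (rule card_Un_Int)
  moreover have "card (P \<union> Q) \<le> card (rsum A)"
    using fin mt by (intro card_mono finite_rsum) (auto simp: P_def Q_def intro!: rsumI)
  ultimately show ?thesis using c by simp
qed simp

lemma card_coset_partition:
  fixes Y H :: "'a::ab_group_add set"
  assumes fin: "finite Y" and H: "H = stab C" and inv: "\<And>h y. h \<in> H \<Longrightarrow> y \<in> Y \<Longrightarrow> h + y \<in> Y"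
  shows "card Y = card ((\<lambda>y. (+) y ` H) ` Y) * card H"
proof -
  have "card {y\<in>Y. (+) y ` H = \<kappa>} = card H" if \<kappa>: "\<kappa> \<in> (\<lambda>y. (+) y ` H) ` Y" for \<kappa>
  proof -
    obtain x where x: "x \<in> Y" "\<kappa> = (+) x ` H" using \<kappa> by blast
    have "{y\<in>Y. (+) y ` H = \<kappa>} = (+) x ` H"
    proof (intro equalityI subsetI)
      fix y assume "y \<in> {y\<in>Y. (+) y ` H = \<kappa>}"
      moreover have "y \<in> (+) y ` H" using H by (intro image_eqI[of _ _ 0]) auto
      ultimately show "y \<in> (+) x ` H" using x by auto
    next
      fix y assume "y \<in> (+) x ` H"
      then obtain h where h: "h \<in> H" "y = x + h" by blast
      have "(+) y ` H = (+) x ` (+) h ` H" using h by (simp add: image_image add.assoc)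
      moreover have "(+) h ` H = H"
      proof (intro equalityI subsetI)
        fix z assume "z \<in> (+) h ` H" then show "z \<in> H" using h H stab_add by blast
      next
        fix z assume "z \<in> H"
        then have "z - h \<in> H" using h H stab_diff by blast
        then show "z \<in> (+) h ` H" by (intro image_eqI[of _ _ "z - h"]) auto
      qed
      moreover have "y \<in> Y" using inv[OF h(1) x(1)] h by (simp add: add.commute)
      ultimately show "y \<in> {y\<in>Y. (+) y ` H = \<kappa>}" using x by simp
    qed
    then show ?thesis by simp
  qed
  moreover have "card Y = (\<Sum>\<kappa>\<in>(\<lambda>y. (+) y ` H) ` Y. card {y\<in>Y. (+) y ` H = \<kappa>})"
    using fin by (subst card_eq_sum, subst sum.image_gen[of Y _ "\<lambda>y. (+) y ` H"]) auto
  ultimately show ?thesis by simp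
qed

lemma coset_eq_iff:
  assumes "H = stab C"
  shows "(+) x ` H = (+) y ` H \<longleftrightarrow> x - y \<in> H"
proof
  assume "(+) x ` H = (+) y ` H"
  moreover have "x \<in> (+) x ` H" using assms by (intro image_eqI[of _ _ 0]) auto
  ultimately show "x - y \<in> H" by auto
next
  assume xy: "x - y \<in> H"
  have sub: "(+) u ` H \<subseteq> (+) v ` H" if "u - v \<in> H" for u v
  proof
    fix z assume "z \<in> (+) u ` H"
    then obtain h where h: "h \<in> H" "z = u + h" by blast
    then have "(u - v) + h \<in> H" using that assms stab_add by blast
    then show "z \<in> (+) v ` H" using h by (intro image_eqI[of _ _ "(u - v) + h"]) auto
  qed
  have "- (x - y) \<in> H" using xy assms stab_uminus by blast
  then show "(+) x ` H = (+) y ` H" using sub[OF xy] sub[of y x] by simp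
qed

text \<open>The subgroup \<open>K\<close> consists of the multiples of its least positive element,
  which divides all of \<open>A\<close> and therefore equals 1.\<close>

lemma subgroup_int_contains_Gcd:
  fixes K :: "int set"
  assumes l: "l \<in> K" "l > 0" and diff: "\<And>x y. x \<in> K \<Longrightarrow> y \<in> K \<Longrightarrow> x - y \<in> K"
    and A: "A \<subseteq> K" "Gcd A = 1"
  shows "x \<in> K"
proof -
  define d where "d = (LEAST n::nat. n > 0 \<and> int n \<in> K)"
  have ex: "nat l > 0 \<and> int (nat l) \<in> K" using l by simp
  then have d: "d > 0" "int d \<in> K" unfolding d_def using LeastI[of "\<lambda>n. n > 0 \<and> int n \<in> K"] by blast+
  have least: "d \<le> n" if "n > 0" "int n \<in> K" for n unfolding d_def using that by (intro Least_le) auto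
  have zero: "0 \<in> K" using diff[OF l(1) l(1)] by simp
  have neg: "- y \<in> K" if "y \<in> K" for y using diff[OF zero that] by simp
  have multn: "int n * int d \<in> K" for n
  proof (induction n)
    case (Suc n)
    have "int n * int d - (- int d) \<in> K" using Suc d neg by (intro diff)
    then show ?case by (simp add: algebra_simps)
  qed (simp add: zero)
  have mult: "k * int d \<in> K" for k :: int
  proof (cases "k \<ge> 0")
    case True
    then show ?thesis using multn[of "nat k"] by simp
  next
    case False
    then show ?thesis using neg[OF multn[of "nat (- k)"]] by simp
  qed
  have "int d dvd a" if "a \<in> K" for a
  proof (rule ccontr)
    assume "\<not> int d dvd a"
    then have "a mod int d \<noteq> 0" by (simp add: dvd_eq_mod_eq_0)
    moreover have "a mod int d \<ge> 0" using d(1) by simp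
    ultimately have pos: "a mod int d > 0" by linarith
    have "a - (a div int d) * int d \<in> K" using that mult by (intro diff)
    then have "a mod int d \<in> K" by (simp add: minus_div_mult_eq_mod)
    then have "d \<le> nat (a mod int d)" using pos by (intro least) auto
    moreover have "a mod int d < int d" using d(1) by simp
    ultimately show False using pos by linarith
  qed
  then have "int d dvd Gcd A" using A(1) by (intro Gcd_greatest) auto
  then have "int d = 1" using A(2) d(1) by simp
  then show ?thesis using mult[of x] by simp
qed

lemma qz_of_zero [simp]: "qz_of l 0 = 0"
  using qz_of_add[of l 0 0] by simp

lemma qz_of_diff: "qz_of l (x - y) = qz_of l x - qz_of l y"
  using qz_of_add[of l "x - y" y] by simp

text \<open>At most two elements have the double \<open>c\<close>, since two of them differ by
  \<open>qz_half\<close>; among three representations one has distinct summands.\<close>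

lemma qz_double_rep:
  assumes "finite B" "3 \<le> card {x\<in>B. c - x \<in> B}"
  shows "c \<in> rsum (B :: qz set)"
proof (rule ccontr)
  assume c: "c \<notin> rsum B"
  have dbl: "x + x = c" if "x \<in> B" "c - x \<in> B" for x
  proof (rule ccontr)
    assume "x + x \<noteq> c"
    then have "x \<noteq> c - x" by (metis diff_add_cancel)
    then have "x + (c - x) \<in> rsum B" using that by (intro rsumI)
    then show False using c by simp
  qed
  have "{x\<in>B. c - x \<in> B} \<noteq> {}" using assms(2) by force
  then obtain x0 where x0: "x0 \<in> B" "c - x0 \<in> B" by blast
  have "{x\<in>B. c - x \<in> B} \<subseteq> {x0, x0 + qz_half}"
  proof
    fix x assume "x \<in> {x\<in>B. c - x \<in> B}"
    then have "(x - x0) + (x - x0) = 0" using dbl x0 by (simp add: algebra_simps)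
    then have "x - x0 = 0 \<or> x - x0 = qz_half" by (rule qz_two_torsion)
    then show "x \<in> {x0, x0 + qz_half}" by (auto simp: algebra_simps)
  qed
  then have "card {x\<in>B. c - x \<in> B} \<le> card {x0, x0 + qz_half}" by (intro card_mono) auto
  also have "\<dots> \<le> 2" by (simp add: card_insert_if)
  finally show False using assms(2) by simp
qed

section \<open>Lifting sums of residues to sums of integers\<close>

text \<open>The normal form of Freiman's theorem. Modulo the largest element only 0 and
  \<open>l\<close> become equal, and the condition on the gcd keeps \<open>A\<close> out of proper
  subgroups.\<close>

locale normalized_set =
  fixes A :: "int set" and l :: int
  assumes fin: "finite A" and zero: "0 \<in> A" and top: "l \<in> A" and pos: "0 < l"
    and range: "A \<subseteq> {0..l}" and gcd: "Gcd A = 1"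
begin

abbreviation "\<pi> \<equiv> qz_of l"
abbreviation "B \<equiv> \<pi> ` A"
abbreviation "H \<equiv> stab (B + B)"

lemma pi_top [simp]: "\<pi> l = 0"
  using qz_of_eq_iff[OF pos, of l 0] by simp

lemma pi_inj: "inj_on \<pi> {0..<l}"
proof (rule inj_onI)
  fix x y assume xy: "x \<in> {0..<l}" "y \<in> {0..<l}" "\<pi> x = \<pi> y"
  then have "l dvd x - y" using qz_of_eq_iff[OF pos] by blast
  moreover have "\<bar>x - y\<bar> < l" using xy by auto
  ultimately show "x = y" using zdvd_not_zless[of "\<bar>x - y\<bar>" l] by fastforce
qed

lemma range_pi: "range \<pi> = \<pi> ` {0..<l}"
proof -
  have "\<pi> x \<in> \<pi> ` {0..<l}" for x
  proof (rule image_eqI)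
    show "\<pi> x = \<pi> (x mod l)" using qz_of_eq_iff[OF pos] by (simp add: minus_mod_eq_mult_div)
    show "x mod l \<in> {0..<l}" using pos by simp
  qed
  then show ?thesis by auto
qed

lemma card_range_pi: "finite (range \<pi>)" "int (card (range \<pi>)) = l"
  unfolding range_pi using pos by (auto simp: card_image[OF pi_inj])

lemma pi_eq_cases:
  assumes "a \<in> A" "b \<in> A" "\<pi> a = \<pi> b" "a \<noteq> b"
  shows "{a, b} = {0, l}"
proof -
  have "a \<notin> {0..<l} \<or> b \<notin> {0..<l}" using pi_inj assms by (auto simp: inj_on_def)
  then consider "a = l" | "b = l" using range assms by force
  then show ?thesis
  proof cases
    case 1
    then have "b \<in> {0..<l}" using range assms by force
    then have "b = 0" using pi_inj assms 1 pos by (auto simp: inj_on_def)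
    then show ?thesis using 1 by auto
  next
    case 2
    then have "a \<in> {0..<l}" using range assms by force
    then have "a = 0" using pi_inj assms 2 pos by (auto simp: inj_on_def)
    then show ?thesis using 2 by auto
  qed
qed

lemma finite_B: "finite B"
  using fin by simp

lemma zero_B: "0 \<in> B"
  using zero by force

lemma card_B: "card A = card B + 1"
proof -
  have "\<pi> a \<in> \<pi> ` (A - {l})" if "a \<in> A" for a
  proof (cases "a = l")
    case True
    then show ?thesis using zero pos by (intro image_eqI[of _ _ 0]) auto
  qed (use that in auto)
  then have "B = \<pi> ` (A - {l})" by auto
  moreover have "inj_on \<pi> (A - {l})" using range by (intro inj_on_subset[OF pi_inj]) force
  ultimately have "card B = card (A - {l})" by (simp add: card_image)
  then show ?thesis using fin top by (metis Suc_eq_plus1 card_Suc_Diff1)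
qed

lemma pi_sumset: "\<pi> ` (A + A) = B + B"
proof (intro equalityI subsetI)
  fix z assume "z \<in> \<pi> ` (A + A)"
  then obtain a b where "a \<in> A" "b \<in> A" "z = \<pi> a + \<pi> b" by (auto elim!: set_plus_elim simp: qz_of_add)
  then show "z \<in> B + B" by blast
next
  fix z assume "z \<in> B + B"
  then obtain a b where "a \<in> A" "b \<in> A" "z = \<pi> (a + b)" by (auto elim!: set_plus_elim simp: qz_of_add)
  then show "z \<in> \<pi> ` (A + A)" by blast
qed

text \<open>The residue 0 has to be added because 0 + l is a sum of two distinct integers whose
  residues agree.\<close>

lemma pi_rsum: "\<pi> ` rsum A = insert 0 (rsum B)"
proof (intro equalityI subsetI)
  fix z assume "z \<in> \<pi> ` rsum A"
  then obtain a b where ab: "a \<in> A" "b \<in> A" "a \<noteq> b" "z = \<pi> a + \<pi> b" by (auto simp: rsum_def qz_of_add)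
  show "z \<in> insert 0 (rsum B)"
  proof (cases "\<pi> a = \<pi> b")
    case True
    then have "{a, b} = {0, l}" using ab by (intro pi_eq_cases)
    then show ?thesis using ab by (auto simp: doubleton_eq_iff)
  next
    case False
    then show ?thesis using ab by (auto intro: rsumI)
  qed
next
  fix z assume "z \<in> insert 0 (rsum B)"
  then consider "z = 0" | "z \<in> rsum B" by blast
  then show "z \<in> \<pi> ` rsum A"
  proof cases
    case 1
    have "0 + l \<in> rsum A" using zero top pos by (intro rsumI) auto
    then show ?thesis using 1 by (intro image_eqI[of _ _ "0 + l"]) (auto simp: pi_top)
  next
    case 2
    then obtain a b where ab: "a \<in> A" "b \<in> A" "\<pi> a \<noteq> \<pi> b" "z = \<pi> (a + b)"
      by (auto simp: rsum_def qz_of_add)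
    then have "a + b \<in> rsum A" by (intro rsumI) auto
    then show ?thesis using ab by blast
  qed
qed

lemma card_vimage_eq_sum:
  assumes "finite X" "finite Y"
  shows "card {x\<in>X. \<pi> x \<in> Y} = (\<Sum>c\<in>Y. card {x\<in>X. \<pi> x = c})"
proof -
  have "card {x\<in>X. \<pi> x \<in> Y} = card (\<Union>c\<in>Y. {x\<in>X. \<pi> x = c})" by (rule arg_cong[of _ _ card]) auto
  also have "\<dots> = (\<Sum>c\<in>Y. card {x\<in>X. \<pi> x = c})"
    using assms by (intro card_UN_disjoint) auto
  finally show ?thesis .
qed

text \<open>Each residue of \<open>B\<close> has one lift a and a second lift a + l, and 0 has the
  third lift 2l; these extra lifts number \<open>card B + 1 = card A\<close>.\<close>

lemma card_fibres_sumset: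
  assumes Y: "B \<subseteq> Y" "Y \<subseteq> B + B"
  shows "card Y + card A \<le> card {x\<in>A + A. \<pi> x \<in> Y}"
proof -
  have finY: "finite Y" using Y(2) by (rule finite_subset) (simp add: finite_B finite_set_plus)
  have finAA: "finite (A + A)" using fin by (simp add: finite_set_plus)
  have "card Y + card A = card Y + card B + card {0::qz}" using card_B by simp
  also have "\<dots> = (\<Sum>c\<in>Y. 1 + (if c \<in> B then 1 else 0) + (if c = 0 then 1 else 0))"
    using finY Y(1) zero_B unfolding sum.distrib by (auto simp: sum.If_cases Int_absorb1)
  also have "\<dots> \<le> (\<Sum>c\<in>Y. card {x\<in>A + A. \<pi> x = c})"
  proof (rule sum_mono)
    fix c assume c: "c \<in> Y"
    have card_ge: "card T \<le> card {x\<in>A + A. \<pi> x = c}" if "T \<subseteq> {x\<in>A + A. \<pi> x = c}" for T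
      using finAA that by (intro card_mono) auto
    consider "c = 0" | "c \<noteq> 0" "c \<in> B" | "c \<notin> B" by blast
    then show "1 + (if c \<in> B then 1 else 0) + (if c = 0 then 1 else 0) \<le> card {x\<in>A + A. \<pi> x = c}"
    proof cases
      case 1
      have "0 + 0 \<in> A + A" "0 + l \<in> A + A" "l + l \<in> A + A" using zero top by blast+
      moreover have "\<pi> (2 * l) = 0" using qz_of_add[of l l l] by simp
      ultimately have "{0, l, l + l} \<subseteq> {x\<in>A + A. \<pi> x = c}" using 1 by auto
      then have "card {0, l, l + l} \<le> card {x\<in>A + A. \<pi> x = c}" by (rule card_ge)
      then show ?thesis using 1 zero_B pos by simp
    next
      case 2
      then obtain a where a: "a \<in> A" "c = \<pi> a" by blast
      have "0 + a \<in> A + A" "l + a \<in> A + A" using zero top a by blast+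
      then have "{a, l + a} \<subseteq> {x\<in>A + A. \<pi> x = c}" using a by (auto simp: qz_of_add)
      then have "card {a, l + a} \<le> card {x\<in>A + A. \<pi> x = c}" by (rule card_ge)
      then show ?thesis using 2 pos by simp
    next
      case 3
      have "c \<in> \<pi> ` (A + A)" unfolding pi_sumset using c Y(2) by (rule set_mp[rotated])
      then obtain x where "x \<in> A + A" "\<pi> x = c" by blast
      then have "card {x} \<le> card {x\<in>A + A. \<pi> x = c}" by (intro card_ge) auto
      then show ?thesis using 3 zero_B by auto
    qed
  qed
  also have "\<dots> = card {x\<in>A + A. \<pi> x \<in> Y}" by (rule card_vimage_eq_sum[OF finAA finY, symmetric])
  finally show ?thesis .
qed

text \<open>Only l = 0 + l is guaranteed as a lift of 0, since 0 + 0 and l + l are not sums of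
  distinct elements; this costs 2 compared with the full sumset.\<close>

lemma card_fibres_rsum:
  assumes Y: "B \<subseteq> Y" "Y \<subseteq> insert 0 (rsum B)"
  shows "card Y + card A \<le> card {x\<in>rsum A. \<pi> x \<in> Y} + 2"
proof -
  have finY: "finite Y" using Y(2) by (rule finite_subset) (simp add: finite_B finite_rsum)
  have finAA: "finite (rsum A)" using fin by (rule finite_rsum)
  have "card (B - {0}) + 2 = card A" 
    using card_B card_Suc_Diff1[OF finite_B zero_B] by simp
  then have "card Y + card A = card Y + card (B - {0}) + 2" by simp
  also have "card Y + card (B - {0}) = (\<Sum>c\<in>Y. 1 + (if c \<in> B - {0} then 1 else 0))"
  proof -
    have "Y \<inter> (B - {0}) = B - {0}" using Y(1) by auto
    then show ?thesis using finY unfolding sum.distrib by (simp add: sum.If_cases Int_def)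
  qed
  also have "\<dots> \<le> (\<Sum>c\<in>Y. card {x\<in>rsum A. \<pi> x = c})"
  proof (rule sum_mono)
    fix c assume c: "c \<in> Y"
    have card_ge: "card T \<le> card {x\<in>rsum A. \<pi> x = c}" if "T \<subseteq> {x\<in>rsum A. \<pi> x = c}" for T
      using finAA that by (intro card_mono) auto
    show "1 + (if c \<in> B - {0} then 1 else 0) \<le> card {x\<in>rsum A. \<pi> x = c}"
    proof (cases "c \<in> B - {0}")
      case True
      then obtain a where a: "a \<in> A" "c = \<pi> a" "c \<noteq> 0" by blast
      then have "a \<noteq> 0" "a \<noteq> l" by auto
      then have "0 + a \<in> rsum A" "l + a \<in> rsum A" using zero top a by (auto intro!: rsumI simp del: add_0)
      then have "{a, l + a} \<subseteq> {x\<in>rsum A. \<pi> x = c}" using a by (auto simp: qz_of_add)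
      then have "card {a, l + a} \<le> card {x\<in>rsum A. \<pi> x = c}" by (rule card_ge)
      then show ?thesis using True pos by simp
    next
      case False
      have "c \<in> \<pi> ` rsum A" unfolding pi_rsum using c Y(2) by (rule set_mp[rotated])
      then obtain x where "x \<in> rsum A" "\<pi> x = c" by blast
      then have "card {x} \<le> card {x\<in>rsum A. \<pi> x = c}" by (intro card_ge) auto
      then show ?thesis using False by auto
    qed
  qed
  also have "(\<Sum>c\<in>Y. card {x\<in>rsum A. \<pi> x = c}) = card {x\<in>rsum A. \<pi> x \<in> Y}"
    by (rule card_vimage_eq_sum[OF finAA finY, symmetric])
  finally show ?thesis by simp
qed

text \<open>Pigeonhole for \<open>B\<close> and its reflection c - B in a group of order
  \<open>l\<close>.\<close>

lemma reps_lower: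
  assumes "c \<in> range \<pi>"
  shows "2 * int (card B) \<le> l + int (card {x\<in>B. c - x \<in> B})"
proof -
  define Q where "Q = (\<lambda>x. c - x) ` B"
  have cQ: "card Q = card B" unfolding Q_def by (rule card_image) (simp add: inj_on_def)
  have finQ: "finite Q" using finite_B by (simp add: Q_def)
  have "B \<union> Q \<subseteq> range \<pi>"
  proof -
    obtain z where z: "c = \<pi> z" using assms by blast
    have "c - \<pi> a \<in> range \<pi>" for a unfolding z qz_of_diff[symmetric] by blast
    then show ?thesis by (auto simp: Q_def)
  qed
  then have "card (B \<union> Q) \<le> card (range \<pi>)" using card_range_pi by (intro card_mono)
  moreover have "card B + card Q = card (B \<union> Q) + card (B \<inter> Q)" using finite_B finQ by (rule card_Un_Int)
  moreover have "card (B \<inter> Q) \<le> card {x\<in>B. c - x \<in> B}"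
    using finite_B by (intro card_mono) (auto simp: Q_def)
  ultimately show ?thesis using cQ card_range_pi(2) by simp
qed

section \<open>Counting lifts coset by coset\<close>

lemma finite_H: "finite H"
proof (rule finite_stab)
  show "finite (B + B)" using finite_B by (simp add: finite_set_plus)
  show "B + B \<noteq> {}" using set_plus_intro[OF zero_B zero_B] by blast
qed

lemma B_subset_double: "B \<subseteq> B + B"
  by (rule set_zero_plus2[OF zero_B])

lemma plus_H_subset_double: "B + H \<subseteq> B + B"
proof
  fix z assume "z \<in> B + H"
  then obtain b h where bh: "b \<in> B" "h \<in> H" "z = h + b" by (auto elim!: set_plus_elim simp: add.commute)
  have "b \<in> B + B" using B_subset_double bh(1) by (rule set_mp)
  then show "z \<in> B + B" unfolding bh(3) by (rule stabD[OF bh(2)])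
qed

lemma add_stab_closed: "h \<in> H \<Longrightarrow> y \<in> B + H \<Longrightarrow> h + y \<in> B + H"
proof -
  assume h: "h \<in> H" and "y \<in> B + H"
  then obtain b h' where bh: "b \<in> B" "h' \<in> H" "y = b + h'" by (auto elim!: set_plus_elim)
  have "b + (h + h') \<in> B + H" using bh(1) stab_add[OF h bh(2)] by (rule set_plus_intro)
  then show ?thesis using bh by (simp add: algebra_simps)
qed

text \<open>\<open>X\<close> is one of the two sumsets; \<open>d\<close> and \<open>e\<close> are 0 and 1 for the full sumset, and 2 and 3 for the
  restricted sumset.\<close>

lemma coset_count:
  assumes finX: "finite X" and image: "\<pi> ` X \<subseteq> B + B"
    and base: "card (B + H) + card A \<le> card {x\<in>X. \<pi> x \<in> B + H} + d"
    and other: "\<And>x y. x \<in> B \<Longrightarrow> y \<in> B \<Longrightarrow>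
      2 * card H + 2 * card B \<le> card {z\<in>X. \<pi> z - (x + y) \<in> H} + 2 * card (B + H) + e"
    and small: "card (B + B) + e \<le> 2 * card B" and not_full: "int (card (B + B)) < l"
  shows "card A + 2 * card B \<le> card X + d + e"
proof -
  define cos where "cos = (\<lambda>x::qz. (+) x ` H)"
  define Q1 where "Q1 = cos ` (B + H)"
  define Q2 where "Q2 = cos ` (B + B)"
  have finBB: "finite (B + B)" and finBH: "finite (B + H)"
    using finite_B finite_H by (simp_all add: finite_set_plus)
  have Q12: "Q1 \<subseteq> Q2" unfolding Q1_def Q2_def using plus_H_subset_double by (rule image_mono)
  have finQ: "finite Q1" "finite Q2" using finBB finBH by (simp_all add: Q1_def Q2_def)
  have cBH: "card (B + H) = card Q1 * card H"
    unfolding Q1_def cos_def by (rule card_coset_partition[OF finBH refl add_stab_closed])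
  have cBB: "card (B + B) = card Q2 * card H"
    unfolding Q2_def cos_def by (rule card_coset_partition[OF finBB refl]) (rule stabD)
  have Hpos: "card H > 0" using finite_H zero_in_stab[of "B + B"] unfolding card_gt_0_iff by blast
  have ne: "B \<noteq> {}" using zero_B by auto
  have Kn: "2 * card (B + H) \<le> card (B + B) + card H"
    using Kneser[OF finite_B finite_B ne ne refl] by simp
  then have "2 * card Q1 * card H \<le> (card Q2 + 1) * card H" using cBH cBB by (simp add: algebra_simps)
  then have q: "2 * card Q1 \<le> card Q2 + 1" using Hpos by (simp only: mult_le_cancel2)
  \<comment> \<open>A single coset would place \<open>A\<close> in the subgroup of integers with
    residue in \<open>H\<close>. As the gcd is 1, this subgroup is everything, and
    \<open>B + B\<close> would contain all residues.\<close>
  have q2: "2 \<le> card Q1"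
  proof (rule ccontr)
    assume "\<not> 2 \<le> card Q1"
    have BH: "B \<subseteq> B + H" by (rule subset_plus_stab)
    have "cos 0 \<in> Q1" unfolding Q1_def using BH zero_B by blast
    then have "card Q1 = 1" using \<open>\<not> 2 \<le> card Q1\<close> finQ(1) card_gt_0_iff[of Q1] by force
    then obtain \<kappa> where \<kappa>: "Q1 = {\<kappa>}" by (rule card_1_singletonE)
    have "b \<in> H" if "b \<in> B" for b
    proof -
      have "cos b \<in> Q1" "cos 0 \<in> Q1" unfolding Q1_def using BH zero_B that by blast+
      then have "cos b = cos 0" using \<kappa> by simp
      then have "b - 0 \<in> H" unfolding cos_def by (simp only: coset_eq_iff[OF refl])
      then show ?thesis by simp
    qed
    then have A: "A \<subseteq> {x. \<pi> x \<in> H}" by auto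
    have "x \<in> {x. \<pi> x \<in> H}" for x
    proof (rule subgroup_int_contains_Gcd[OF _ pos _ A gcd])
      show "l \<in> {x. \<pi> x \<in> H}" by simp
      show "x - y \<in> {x. \<pi> x \<in> H}" if "x \<in> {x. \<pi> x \<in> H}" "y \<in> {x. \<pi> x \<in> H}" for x y
        using that stab_diff by (simp add: qz_of_diff)
    qed
    then have "range \<pi> \<subseteq> H" by auto
    then have "card (range \<pi>) \<le> card H" using finite_H by (intro card_mono)
    also have "\<dots> = card (B + H)" using cBH \<open>card Q1 = 1\<close> by simp
    also have "\<dots> \<le> card (B + B)" using finBB plus_H_subset_double by (rule card_mono)
    finally show False using not_full card_range_pi(2) by simp
  qed
  \<comment> \<open>A lower bound for the part of \<open>X\<close> over any coset in
    \<open>B + B\<close>. By \<open>q\<close> at least \<open>card Q1 - 1\<close> such cosets avoid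
    \<open>B + H\<close>, and their parts are added to the count over \<open>B + H\<close>.\<close>
  define c where "c = int (card H) * 2 + int (card B) * 2 - int (card (B + H)) * 2 - int e"
  have other': "c \<le> int (card {x\<in>X. cos (\<pi> x) = \<kappa>})" if \<kappa>: "\<kappa> \<in> Q2" for \<kappa>
  proof -
    obtain x y where xy: "x \<in> B" "y \<in> B" "\<kappa> = cos (x + y)"
      using \<kappa> unfolding Q2_def by (auto elim!: set_plus_elim)
    have "{z\<in>X. \<pi> z - (x + y) \<in> H} = {z\<in>X. cos (\<pi> z) = \<kappa>}"
      unfolding xy(3) cos_def coset_eq_iff[OF refl] ..
    then show ?thesis using other[OF xy(1,2)] unfolding c_def by simp
  qed
  have "int (card {x\<in>X. \<pi> x \<in> B + H}) + (int (card Q1) - 1) * c \<le> int (card X)"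
  proof -
    have c0: "0 \<le> c" using Kn small unfolding c_def by linarith
    have "(int (card Q1) - 1) * c \<le> int (card (Q2 - Q1)) * c"
    proof (rule mult_right_mono[OF _ c0])
      have "card (Q2 - Q1) = card Q2 - card Q1" "card Q1 \<le> card Q2"
        using finQ Q12 by (auto intro: card_Diff_subset card_mono)
      then show "int (card Q1) - 1 \<le> int (card (Q2 - Q1))" using q by simp
    qed
    also have "\<dots> = (\<Sum>\<kappa>\<in>Q2 - Q1. c)" by simp
    also have "\<dots> \<le> (\<Sum>\<kappa>\<in>Q2 - Q1. int (card {x\<in>X. cos (\<pi> x) = \<kappa>}))"
      using other' by (intro sum_mono) auto
    also have "\<dots> = int (card (\<Union>\<kappa>\<in>Q2 - Q1. {x\<in>X. cos (\<pi> x) = \<kappa>}))"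
      unfolding of_nat_sum[symmetric] using finX finQ
      by (intro arg_cong[of _ _ int] card_UN_disjoint[symmetric]) auto
    finally have 1: "(int (card Q1) - 1) * c \<le> int (card (\<Union>\<kappa>\<in>Q2 - Q1. {x\<in>X. cos (\<pi> x) = \<kappa>}))" .
    have disj: "{x\<in>X. \<pi> x \<in> B + H} \<inter> (\<Union>\<kappa>\<in>Q2 - Q1. {x\<in>X. cos (\<pi> x) = \<kappa>}) = {}"
      unfolding Q1_def by auto
    have "card {x\<in>X. \<pi> x \<in> B + H} + card (\<Union>\<kappa>\<in>Q2 - Q1. {x\<in>X. cos (\<pi> x) = \<kappa>})
      = card ({x\<in>X. \<pi> x \<in> B + H} \<union> (\<Union>\<kappa>\<in>Q2 - Q1. {x\<in>X. cos (\<pi> x) = \<kappa>}))"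
      using finX by (intro card_Un_disjoint[OF _ _ disj, symmetric]) (auto intro: finite_subset[OF _ finX])
    also have "\<dots> \<le> card X" using finX by (intro card_mono) auto
    finally show ?thesis using 1 by linarith
  qed
  moreover have "int (card (B + H)) + (int (card Q1) - 1) * c \<ge> 2 * int (card B) - int e"
  proof -
    have BH: "int (card (B + H)) = int (card Q1) * int (card H)" using cBH by simp
    \<comment> \<open>This expression times \<open>card Q1 - 2\<close> is exactly the difference of
      the two sides to be compared; it is nonnegative by Kneser's theorem and
      \<open>small\<close>.\<close>
    have "0 \<le> int (card H) + 2 * int (card B) - 2 * int (card (B + H)) - int e"
      using Kn small by linarith
    then have "0 \<le> (int (card Q1) - 2) * (int (card H) + 2 * int (card B) - 2 * int (card (B + H)) - int e)"
      using q2 by simp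
    then show ?thesis unfolding c_def BH by (simp add: algebra_simps)
  qed
  ultimately show ?thesis using base by linarith
qed

lemma class_card:
  assumes "x \<in> B"
  shows "card H + card B \<le> card {a\<in>A. \<pi> a - x \<in> H} + card (B + H)" "{a\<in>A. \<pi> a - x \<in> H} \<noteq> {}"
proof -
  have "card H + card B \<le> card {z\<in>B. z - x \<in> H} + card (B + H)"
    by (rule card_stab_le_coset[OF finite_B finite_H refl assms])
  moreover have "{z\<in>B. z - x \<in> H} = \<pi> ` {a\<in>A. \<pi> a - x \<in> H}" by auto
  moreover have "card (\<pi> ` {a\<in>A. \<pi> a - x \<in> H}) \<le> card {a\<in>A. \<pi> a - x \<in> H}"
    using fin by (intro card_image_le) auto
  ultimately show "card H + card B \<le> card {a\<in>A. \<pi> a - x \<in> H} + card (B + H)" by simp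
  obtain a where "a \<in> A" "x = \<pi> a" using assms by blast
  then have "a \<in> {a\<in>A. \<pi> a - x \<in> H}" by simp
  then show "{a\<in>A. \<pi> a - x \<in> H} \<noteq> {}" by blast
qed

lemma class_sumset_subset:
  assumes "a \<in> {a\<in>A. \<pi> a - x \<in> H}" "b \<in> {a\<in>A. \<pi> a - y \<in> H}"
  shows "\<pi> (a + b) - (x + y) \<in> H"
proof -
  have "(\<pi> a - x) + (\<pi> b - y) \<in> H" using assms by (intro stab_add) auto
  then show ?thesis by (simp add: qz_of_add algebra_simps)
qed

text \<open>The classes of \<open>A\<close> are added as sets of integers, which loses only 1; their
  sizes come from the hole count.\<close>

lemma class_sums:
  assumes x: "x \<in> B" and y: "y \<in> B"
  shows "2 * card H + 2 * card B \<le> card {z\<in>A + A. \<pi> z - (x + y) \<in> H} + 2 * card (B + H) + 1"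
proof -
  let ?C = "\<lambda>x. {a\<in>A. \<pi> a - x \<in> H}"
  have finC: "finite (?C u)" for u using fin by simp
  have "card (?C x) + card (?C y) \<le> card (?C x + ?C y) + 1"
    using card_sumset_int[OF finC finC] class_card(2) x y by blast
  moreover have "card (?C x + ?C y) \<le> card {z\<in>A + A. \<pi> z - (x + y) \<in> H}"
  proof (rule card_mono)
    show "finite {z\<in>A + A. \<pi> z - (x + y) \<in> H}" using fin by (simp add: finite_set_plus)
    show "?C x + ?C y \<subseteq> {z\<in>A + A. \<pi> z - (x + y) \<in> H}"
    proof
      fix z assume "z \<in> ?C x + ?C y"
      then obtain a b where ab: "z = a + b" "a \<in> ?C x" "b \<in> ?C y" by (rule set_plus_elim)
      then have "a + b \<in> A + A" by blast
      then show "z \<in> {z\<in>A + A. \<pi> z - (x + y) \<in> H}" using class_sumset_subset[OF ab(2,3)] ab(1) by simp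
    qed
  qed
  ultimately show ?thesis using class_card(1)[OF x] class_card(1)[OF y] by linarith
qed

text \<open>Different classes are disjoint, so their sums automatically have distinct summands.
  Within a single class the bound for pairwise sums of integers loses 3.\<close>

lemma class_rsums:
  assumes x: "x \<in> B" and y: "y \<in> B"
  shows "2 * card H + 2 * card B \<le> card {z\<in>rsum A. \<pi> z - (x + y) \<in> H} + 2 * card (B + H) + 3"
proof -
  let ?C = "\<lambda>x. {a\<in>A. \<pi> a - x \<in> H}"
  have finC: "finite (?C u)" for u using fin by simp
  have finR: "finite {z\<in>rsum A. \<pi> z - (x + y) \<in> H}" using finite_rsum[OF fin] by simp
  have "card (?C x) + card (?C y) \<le> card {z\<in>rsum A. \<pi> z - (x + y) \<in> H} + 3"
  proof (cases "x - y \<in> H")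
    case True
    have "?C x = ?C y"
    proof -
      have "\<pi> a - y \<in> H" if "\<pi> a - x \<in> H" for a using stab_add[OF that True] by simp
      moreover have "\<pi> a - x \<in> H" if "\<pi> a - y \<in> H" for a using stab_diff[OF that True] by simp
      ultimately show ?thesis by blast
    qed
    have "rsum (?C x) \<subseteq> {z\<in>rsum A. \<pi> z - (x + y) \<in> H}"
    proof
      fix z assume "z \<in> rsum (?C x)"
      then obtain a b where ab: "z = a + b" "a \<in> ?C x" "b \<in> ?C x" "a \<noteq> b"
        unfolding rsum_def by blast
      then have "b \<in> ?C y" using \<open>?C x = ?C y\<close> by blast
      moreover have "a + b \<in> rsum A" using ab by (intro rsumI) auto
      ultimately show "z \<in> {z\<in>rsum A. \<pi> z - (x + y) \<in> H}" using class_sumset_subset[OF ab(2)] ab(1) by simp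
    qed
    then have "card (rsum (?C x)) \<le> card {z\<in>rsum A. \<pi> z - (x + y) \<in> H}" using finR by (intro card_mono)
    then show ?thesis using card_rsum_int[OF finC[of x]] \<open>?C x = ?C y\<close> by simp
  next
    case False
    have "?C x + ?C y \<subseteq> {z\<in>rsum A. \<pi> z - (x + y) \<in> H}"
    proof
      fix z assume "z \<in> ?C x + ?C y"
      then obtain a b where ab: "z = a + b" "a \<in> ?C x" "b \<in> ?C y" by (rule set_plus_elim)
      have "a \<noteq> b"
      proof
        assume "a = b"
        then have "\<pi> a - y \<in> H" "\<pi> a - x \<in> H" using ab by auto
        then have "(\<pi> a - y) - (\<pi> a - x) \<in> H" by (rule stab_diff)
        then show False using False by simp
      qed
      then have "a + b \<in> rsum A" using ab by (intro rsumI) auto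
      then show "z \<in> {z\<in>rsum A. \<pi> z - (x + y) \<in> H}" using class_sumset_subset[OF ab(2,3)] ab(1) by simp
    qed
    then have "card (?C x + ?C y) \<le> card {z\<in>rsum A. \<pi> z - (x + y) \<in> H}" using finR by (intro card_mono)
    moreover have "card (?C x) + card (?C y) \<le> card (?C x + ?C y) + 1"
      using card_sumset_int[OF finC finC] class_card(2) x y by blast
    ultimately show ?thesis by linarith
  qed
  then show ?thesis using class_card(1)[OF x] class_card(1)[OF y] by linarith
qed

section \<open>The bounds for the full and the restricted sumset\<close>

theorem Freiman_sumset:
  shows "l \<le> 2 * int (card A) - 3 \<Longrightarrow> l + int (card A) \<le> int (card (A + A))"
    and "2 * int (card A) - 2 \<le> l \<Longrightarrow> 3 * int (card A) - 3 \<le> int (card (A + A))"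
proof -
  have finAA: "finite (A + A)" using fin by (simp add: finite_set_plus)
  have finBB: "finite (B + B)" using finite_B by (simp add: finite_set_plus)
  have all: "card (B + B) + card A \<le> card (A + A)"
  proof -
    have "{x\<in>A + A. \<pi> x \<in> B + B} \<subseteq> A + A" by blast
    then have "card {x\<in>A + A. \<pi> x \<in> B + B} \<le> card (A + A)" using finAA by (intro card_mono)
    then show ?thesis using card_fibres_sumset[OF B_subset_double order_refl] by linarith
  qed
  show "l + int (card A) \<le> int (card (A + A))" if l: "l \<le> 2 * int (card A) - 3"
  proof -
    \<comment> \<open>Here \<open>2 * card B = 2 * card A - 2\<close> exceeds \<open>l\<close>, so
      every residue has a representation.\<close>
    have "range \<pi> \<subseteq> B + B"
    proof
      fix c assume "c \<in> range \<pi>"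
      from reps_lower[OF this] have "0 < card {x\<in>B. c - x \<in> B}" using l card_B by simp
      then have "{x\<in>B. c - x \<in> B} \<noteq> {}" by (metis card.empty less_numeral_extra(3))
      then obtain x where "x \<in> B" "c - x \<in> B" by blast
      then have "x + (c - x) \<in> B + B" by (rule set_plus_intro)
      then show "c \<in> B + B" by simp
    qed
    then have "card (range \<pi>) \<le> card (B + B)" using finBB by (intro card_mono)
    then show ?thesis using all card_range_pi(2) by simp
  qed
  show "3 * int (card A) - 3 \<le> int (card (A + A))" if l: "2 * int (card A) - 2 \<le> l"
  proof (cases "2 * card B \<le> card (B + B) + 1")
    case True
    then show ?thesis using all card_B by simp
  next
    case False
    have "card A + 2 * card B \<le> card (A + A) + 0 + 1"
    proof (rule coset_count[OF finAA])
      show "\<pi> ` (A + A) \<subseteq> B + B" by (simp add: pi_sumset)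
      show "card (B + H) + card A \<le> card {x\<in>A + A. \<pi> x \<in> B + H} + 0"
        using card_fibres_sumset[OF subset_plus_stab plus_H_subset_double] by simp
      show "card (B + B) + 1 \<le> 2 * card B" using False by simp
      show "int (card (B + B)) < l" using False l card_B by simp
    qed (rule class_sums)
    then show ?thesis using card_B by simp
  qed
qed

theorem Lev_rsum:
  shows "l \<le> 2 * int (card A) - 5 \<Longrightarrow> l + int (card A) - 2 \<le> int (card (rsum A))"
    and "4 \<le> card A \<Longrightarrow> 2 * int (card A) - 4 \<le> l \<Longrightarrow>
      (golden + 1) * real (card A) - 6 \<le> real (card (rsum A))"
proof -
  define S where "S = insert 0 (rsum B)"
  have finA: "finite (rsum A)" using fin by (rule finite_rsum)
  have finS: "finite S" using finite_rsum[OF finite_B] by (simp add: S_def)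
  have BS: "B \<subseteq> S" unfolding S_def using zero_B by (rule subset_insert_rsum)
  have all: "card S + card A \<le> card (rsum A) + 2"
  proof -
    have "{x\<in>rsum A. \<pi> x \<in> S} \<subseteq> rsum A" by blast
    then have "card {x\<in>rsum A. \<pi> x \<in> S} \<le> card (rsum A)" using finA by (intro card_mono)
    then show ?thesis using card_fibres_rsum[OF BS] unfolding S_def by fastforce
  qed
  show "l + int (card A) - 2 \<le> int (card (rsum A))" if l: "l \<le> 2 * int (card A) - 5"
  proof -
    \<comment> \<open>Now \<open>l\<close> is at most \<open>2 * card B - 3\<close>, which leaves
      three representations of each residue, enough for one with distinct summands.\<close>
    have "range \<pi> \<subseteq> S"
    proof
      fix c assume "c \<in> range \<pi>"
      from reps_lower[OF this] have "3 \<le> card {x\<in>B. c - x \<in> B}" using l card_B by simp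
      then have "c \<in> rsum B" by (rule qz_double_rep[OF finite_B])
      then show "c \<in> S" by (simp add: S_def)
    qed
    then have "card (range \<pi>) \<le> card S" using finS by (intro card_mono)
    then show ?thesis using all card_range_pi(2) by simp
  qed
  show "(golden + 1) * real (card A) - 6 \<le> real (card (rsum A))"
    if n: "4 \<le> card A" and l: "2 * int (card A) - 4 \<le> l"
  proof (cases "\<exists>w\<in>B. w + w \<notin> S")
    case True
    then obtain w where "w \<in> B" "w + w \<notin> insert 0 (rsum B)" by (auto simp: S_def)
    then have "golden * (real (card B) + 1) - 4 \<le> real (card S)"
      unfolding S_def using n card_B
      by (intro card_rsum_golden[OF finite_B zero_B _ qz_two_torsion]) auto
    then have "golden * real (card A) - 4 \<le> real (card S)" using card_B by (simp add: add.commute)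
    moreover have "real (card S) + real (card A) \<le> real (card (rsum A)) + 2"
      using all by linarith
    ultimately show ?thesis by (simp add: algebra_simps)
  next
    case False
    have SBB: "S = B + B"
    proof (intro equalityI subsetI)
      fix z assume "z \<in> S"
      then consider "z = 0 + 0" | x y where "x \<in> B" "y \<in> B" "z = x + y"
        by (auto simp: S_def rsum_def)
      then show "z \<in> B + B" using zero_B by cases (blast intro: set_plus_intro)+
    next
      fix z assume "z \<in> B + B"
      then obtain x y where xy: "z = x + y" "x \<in> B" "y \<in> B" by (rule set_plus_elim)
      show "z \<in> S"
      proof (cases "x = y")
        case True
        then show ?thesis using False xy by auto
      next
        case neq: False
        then have "x + y \<in> rsum B" using xy by (intro rsumI)
        then show ?thesis using xy by (simp add: S_def)
      qed
    qed
    \<comment> \<open>No double is missing from \<open>S\<close>, so Kneser's theorem applies as for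
      the full sumset and yields slope 3 up to a constant.\<close>
    have "3 * card A \<le> card (rsum A) + 7"
    proof (cases "2 * card B \<le> card (B + B) + 2")
      case True
      then show ?thesis using all card_B SBB by simp
    next
      case False
      have "card A + 2 * card B \<le> card (rsum A) + 2 + 3"
      proof (rule coset_count[OF finA])
        show "\<pi> ` rsum A \<subseteq> B + B" using SBB by (simp add: pi_rsum S_def)
        have "B + H \<subseteq> insert 0 (rsum B)" using plus_H_subset_double SBB by (simp add: S_def)
        then show "card (B + H) + card A \<le> card {x\<in>rsum A. \<pi> x \<in> B + H} + 2"
          by (rule card_fibres_rsum[OF subset_plus_stab])
        show "card (B + B) + 3 \<le> 2 * card B" using False by simp
        show "int (card (B + B)) < l" using False l card_B by simp
      qed (rule class_rsums)
      then show ?thesis using card_B by simp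
    qed
    then have 1: "3 * real (card A) \<le> real (card (rsum A)) + 7" by linarith
    \<comment> \<open>For n = \<open>card A\<close> the bound 3n - 7 has to dominate (golden + 1)n -
      6, that is, (2 - golden)n \<ge> 1. For n \<ge> 4 the estimate 7/4 just suffices.\<close>
    have "golden \<le> 7 / 4"
    proof -
      have "sqrt 5 \<le> 5 / 2" by (rule real_le_lsqrt) (auto simp: power2_eq_square)
      then show ?thesis by (simp add: golden_def)
    qed
    then have 2: "golden * real (card A) \<le> 7 / 4 * real (card A)" by (rule mult_right_mono) simp
    have "(golden + 1) * real (card A) = golden * real (card A) + real (card A)" by (rule distrib_right[of golden 1, simplified])
    moreover have "4 \<le> real (card A)" using n by simp
    ultimately show ?thesis using 1 2 by linarith
  qed
qed

end

section \<open>Subsequence sums\<close>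

lemma finite_subseq_sums: "finite (subseq_sums n M)"
proof -
  have "{B. B \<subseteq># M} \<subseteq> mset ` {xs. set xs \<subseteq> set_mset M \<and> length xs \<le> size M}"
  proof
    fix B assume "B \<in> {B. B \<subseteq># M}"
    then have B: "B \<subseteq># M" by simp
    obtain xs where xs: "mset xs = B" using ex_mset by blast
    have "set xs = set_mset B" "length xs = size B" using xs by auto
    then have "set xs \<subseteq> set_mset M" "length xs \<le> size M"
      using B set_mset_mono[OF B] size_mset_mono[OF B] by simp_all
    then show "B \<in> mset ` {xs. set xs \<subseteq> set_mset M \<and> length xs \<le> size M}"
      using xs by (intro image_eqI[of _ _ xs]) auto
  qed
  moreover have "finite {xs. set xs \<subseteq> set_mset M \<and> length xs \<le> size M}"
    by (rule finite_lists_length_le) simp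
  ultimately have "finite {B. B \<subseteq># M}" by (rule finite_surj[rotated])
  moreover have "subseq_sums n M \<subseteq> sum_mset ` {B. B \<subseteq># M}" by (auto simp: subseq_sums_def)
  ultimately show ?thesis by (rule finite_surj)
qed

text \<open>Deleting at most two terms with sum \<open>d\<close> leaves a long subsequence with sum
  \<open>\<Sum>\<^sub># M - d\<close>, and different \<open>d\<close> leave different sums.\<close>

lemma card_le_subseq_sums:
  assumes "\<And>d. d \<in> D \<Longrightarrow> \<exists>C. C \<subseteq># M \<and> size C \<le> 2 \<and> \<Sum>\<^sub># C = d"
  shows "card D \<le> card (subseq_sums (size M - 2) M)"
proof (rule card_inj_on_le[OF _ _ finite_subseq_sums])
  show "inj_on (\<lambda>d. \<Sum>\<^sub># M - d) D" by (simp add: inj_on_def)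
  show "(\<lambda>d. \<Sum>\<^sub># M - d) ` D \<subseteq> subseq_sums (size M - 2) M"
  proof
    fix x assume "x \<in> (\<lambda>d. \<Sum>\<^sub># M - d) ` D"
    then obtain C where C: "C \<subseteq># M" "size C \<le> 2" "x = \<Sum>\<^sub># M - \<Sum>\<^sub># C" using assms by blast
    obtain E where E: "M = C + E" using C(1) by (metis subset_mset.le_iff_add)
    then have "x = \<Sum>\<^sub># E" "E \<subseteq># M" "size E \<ge> size M - 2" using C by auto
    then show "x \<in> subseq_sums (size M - 2) M" unfolding subseq_sums_def by blast
  qed
qed

lemma size_seq_of: "size (seq_of k a r) = (\<Sum>i<k. r i)"
  by (induction k) (simp_all add: seq_of_def)

lemma count_seq_of_ge: "i < k \<Longrightarrow> r i \<le> count (seq_of k a r) (a i)"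
  by (induction k) (auto simp: seq_of_def less_Suc_eq)

theorem theorem6p6:
  fixes k \<alpha> rmin :: nat and a :: "nat \<Rightarrow> int" and r :: "nat \<Rightarrow> nat"
  assumes "k \<ge> 4"
    and "a 0 = 0"
    and "strict_mono_on {..<k} a"
    and "\<forall>i<k. r i \<ge> 1"
    and "Gcd (a ` {..<k}) = 1"
    and "rmin = Min (r ` {1..k - 1})"
    and "\<alpha> = (\<Sum>i<k. r i) - 2"
  shows "(rmin = 1 \<longrightarrow>
            (a (k - 1) \<le> 2 * int k - 5 \<longrightarrow>
               int (card (subseq_sums \<alpha> (seq_of k a r))) \<ge> a (k - 1) + int k - 1) \<and>
            (a (k - 1) \<ge> 2 * int k - 4 \<longrightarrow>
               real (card (subseq_sums \<alpha> (seq_of k a r))) \<ge> (golden + 1) * real k - 5)) \<and>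
         (rmin \<ge> 2 \<longrightarrow>
            (a (k - 1) \<le> 2 * int k - 3 \<longrightarrow>
               int (card (subseq_sums \<alpha> (seq_of k a r))) \<ge> a (k - 1) + int k) \<and>
            (a (k - 1) \<ge> 2 * int k - 2 \<longrightarrow>
               int (card (subseq_sums \<alpha> (seq_of k a r))) \<ge> 3 * int k - 3))"
proof -
  define A where "A = a ` {..<k}"
  define M where "M = seq_of k a r"
  define N where "N = card (subseq_sums \<alpha> M)"
  have mono: "a i < a j" if "i < j" "j < k" for i j
    using strict_mono_onD[OF assms(3)] that by auto
  have monole: "a i \<le> a j" if "i \<le> j" "j < k" for i j
    using mono[of i j] that by (cases "i = j") auto
  have inj: "inj_on a {..<k}" using assms(3) by (rule strict_mono_on_imp_inj_on)
  have cardA: "card A = k" by (simp add: A_def card_image[OF inj])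
  have Apos: "0 \<le> x" if "x \<in> A" for x
    using that monole[of 0] assms(2) by (auto simp: A_def)
  have \<alpha>: "\<alpha> = size M - 2" using assms(7) by (simp add: M_def size_seq_of)
  interpret normalized_set A "a (k - 1)"
  proof
    show "finite A" by (simp add: A_def)
    show "0 \<in> A" unfolding A_def using assms(1,2) by (intro image_eqI[of _ _ 0]) auto
    show "a (k - 1) \<in> A" using assms(1) by (simp add: A_def)
    show "0 < a (k - 1)" using mono[of 0 "k - 1"] assms(1,2) by simp
    show "A \<subseteq> {0..a (k - 1)}" using Apos monole[of _ "k - 1"] assms(1) by (auto simp: A_def)
    show "Gcd A = 1" using assms(5) by (simp add: A_def)
  qed
  have count1: "1 \<le> count M x" if x: "x \<in> A" for x
  proof -
    obtain i where i: "i < k" "x = a i" using x by (auto simp: A_def)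
    then have "1 \<le> r i" "r i \<le> count M x" using assms(4) count_seq_of_ge[of i k r a] by (auto simp: M_def)
    then show ?thesis by (rule le_trans)
  qed
  have pair: "\<exists>C. C \<subseteq># M \<and> size C \<le> 2 \<and> \<Sum>\<^sub># C = x + y" if "x \<in> A" "y \<in> A" "x \<noteq> y" for x y
    using that count1[of x] count1[of y]
    by (intro exI[of _ "{#x, y#}"]) (auto simp: subseteq_mset_def)
  have empty: "\<exists>C. C \<subseteq># M \<and> size C \<le> 2 \<and> \<Sum>\<^sub># C = 0"
    by (intro exI[of _ "{#}"]) auto
  \<comment> \<open>Deleting nothing contributes the additional 1: distinct nonnegative integers
    have a positive sum, so 0 is not a restricted sum.\<close>
  have R: "card (rsum A) + 1 \<le> N"
  proof -
    have "0 \<notin> rsum A"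
    proof
      assume "0 \<in> rsum A"
      then obtain x y where "x \<in> A" "y \<in> A" "x \<noteq> y" "0 = x + y" unfolding rsum_def by blast
      then show False using Apos[of x] Apos[of y] by simp
    qed
    then have "card (insert 0 (rsum A)) = card (rsum A) + 1" using finite_rsum[OF fin] by simp
    moreover have "card (insert 0 (rsum A)) \<le> N"
      unfolding N_def \<alpha> by (rule card_le_subseq_sums) (auto simp: rsum_def pair empty)
    ultimately show ?thesis by simp
  qed
  have D: "card (A + A) \<le> N" if rmin: "rmin \<ge> 2"
    unfolding N_def \<alpha>
  proof (rule card_le_subseq_sums)
    fix d assume "d \<in> A + A"
    then obtain x y where xy: "d = x + y" "x \<in> A" "y \<in> A" by (rule set_plus_elim)
    show "\<exists>C. C \<subseteq># M \<and> size C \<le> 2 \<and> \<Sum>\<^sub># C = d"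
    proof (cases "x = y")
      case False
      then show ?thesis using pair xy by blast
    next
      case True
      \<comment> \<open>The minimum \<open>rmin\<close> does not control the multiplicity of 0; the
        sum 0 + 0 is obtained by deleting nothing.\<close>
      show ?thesis
      proof (cases "x = 0")
        case True
        then show ?thesis using empty xy \<open>x = y\<close> by simp
      next
        case False
        obtain i where i: "i < k" "x = a i" using xy by (auto simp: A_def)
        then have "i \<in> {1..k - 1}" using False assms(2) by (cases i) auto
        then have "rmin \<le> r i" unfolding assms(6) by (intro Min_le) auto
        then have "2 \<le> count M x" using rmin count_seq_of_ge[OF i(1), of r a] i by (simp add: M_def)
        then show ?thesis using True xy
          by (intro exI[of _ "{#x, x#}"]) (auto simp: subseteq_mset_def)
      qed
    qed
  qed
  have R': "real (card (rsum A)) + 1 \<le> real N" using R by linarith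
  have g: "(golden + 1) * real k - 5 \<le> real N" if "2 * int k - 4 \<le> a (k - 1)"
    using Lev_rsum(2) that cardA assms(1) R' by fastforce
  show ?thesis
    unfolding M_def[symmetric] N_def[symmetric]
    using Freiman_sumset Lev_rsum(1) g R D cardA by fastforce
qed

end
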